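(* Assume the Strong Exponential-Time Hypothesis. Then for every integer $\ell \geq 3$ and every real $\varepsilon > 0$, there is no algorithm that, given an $n$-vertex graph $G$ and $k\in\mathbb{N}$, computes the number of $k$-element subsets $X\subseteq V(G)$ such that $G[X]$ is an $\ell$-scorpion, in time $O(n^{\ell + 2 - \varepsilon})$.
   Context: Graphs are finite, simple and undirected; $\mathbb{N}=\{1,2,3,\dots\}$. For $\ell\in\mathbb{N}$, an $\ell$-scorpion is a graph $H$ with $|V(H)|\ge \ell+4$ that admits a tuple of pairwise distinct vertices $(b,t_1,\dots,t_\ell,s)\in V(H)^{\ell+2}$ such that, writing $Q=\{b,t_1,\dots,t_\ell,s\}$ and calling the vertices in $V(H)\setminus Q$ legs: (i) $H[Q]$ is an induced path from $b$ to $s$ whose vertices in order are $b,t_1,\dots,t_\ell,s$; (ii) $b$ is adjacent to all legs; (iii) $b$ is the only vertex in $Q$ adjacent to legs. The Strong Exponential-Time Hypothesis (SETH) asserts that for every $\varepsilon>0$ there is some $q\ge 3$ such that satisfiability of $n$-variable $q$-CNF formulas cannot be decided in time $O(2^{(1-\varepsilon)n})$. *)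

theory Defs
  imports
    "Graph_Theory.Digraph_Component"
    "HOL-Library.Landau_Symbols"
    "HOL-Library.Discrete_Functions"
begin

section \<open>Scorpions\<close>

text \<open>
  Finite simple undirected graphs are those satisfying the locale predicate \<^const>\<open>graph\<close>: finite
  digraphs without loops or parallel arcs whose adjacency relation \<open>u \<rightarrow>\<^bsub>H\<^esub> v\<close> is symmetric.
  The list \<open>p\<close> below is \<open>(b, t\<^sub>1, \<dots>, t\<^sub>l, s)\<close>, so that \<open>set p\<close> is \<open>Q\<close>.
\<close>

definition scorpion :: "nat \<Rightarrow> ('a, 'b) pre_digraph \<Rightarrow> bool" where
  "scorpion l H \<longleftrightarrow>
     graph H \<and> card (verts H) \<ge> l + 4 \<and>
     (\<exists>b ts s. let p = b # ts @ [s] in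
        length ts = l \<and> distinct p \<and> set p \<subseteq> verts H \<and>
        (\<forall>i j. i < j \<and> j < length p \<longrightarrow> (p ! i \<rightarrow>\<^bsub>H\<^esub> p ! j) = (j = Suc i)) \<and>
        (\<forall>x \<in> verts H - set p. b \<rightarrow>\<^bsub>H\<^esub> x) \<and>
        (\<forall>x \<in> verts H - set p. \<forall>y \<in> set p - {b}. \<not> (y \<rightarrow>\<^bsub>H\<^esub> x)))"

definition scorpion_count :: "nat \<Rightarrow> ('a, 'b) pre_digraph \<Rightarrow> nat \<Rightarrow> nat" where
  "scorpion_count l G k = card {X. X \<subseteq> verts G \<and> card X = k \<and> scorpion l (G \<restriction> X)}"


section \<open>Random access machines with logarithmic cost\<close>

text \<open>
  An algorithm is a program of a random access machine, written as a structured program over an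
  infinite memory of natural numbers. Running time is logarithmic cost: every evaluation of a
  subexpression is charged the bit length of the value it produces (hence memory accesses are
  charged for both the address and the contents). Up to factors polylogarithmic in the running
  time this is the time of a word RAM whose words hold \<open>O(log T)\<close> bits, \<open>T\<close> being the running time;
  such factors are absorbed by the quantification over \<open>\<epsilon>\<close> in the statements of interest. Unlike
  unit cost, it gives no unrealistic power to arithmetic on long numbers.
\<close>

type_synonym mem = "nat \<Rightarrow> nat"

datatype expr =
    Num nat
  | Mem expr
  | Plus expr expr
  | Minus expr expr
  | Times expr expr
  | Div expr expr

fun val :: "expr \<Rightarrow> mem \<Rightarrow> nat" where
  "val (Num c) m = c"
| "val (Mem e) m = m (val e m)"
| "val (Plus e f) m = val e m + val f m"
| "val (Minus e f) m = val e m - val f m"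
| "val (Times e f) m = val e m * val f m"
| "val (Div e f) m = val e m div val f m"

text \<open>The number \<open>0\<close> has bit length \<open>1\<close>.\<close>

definition bit_length :: "nat \<Rightarrow> nat" where
  "bit_length n = Suc (floor_log n)"

fun cost :: "expr \<Rightarrow> mem \<Rightarrow> nat" where
  "cost (Num c) m = bit_length (val (Num c) m)"
| "cost (Mem e) m = cost e m + bit_length (val (Mem e) m)"
| "cost (Plus e f) m = cost e m + cost f m + bit_length (val (Plus e f) m)"
| "cost (Minus e f) m = cost e m + cost f m + bit_length (val (Minus e f) m)"
| "cost (Times e f) m = cost e m + cost f m + bit_length (val (Times e f) m)"
| "cost (Div e f) m = cost e m + cost f m + bit_length (val (Div e f) m)"

text \<open>\<open>Store a e\<close> writes the value of \<open>e\<close> to the memory cell whose address is the value of \<open>a\<close>.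
  A test succeeds if its value is nonzero.\<close>

datatype prog =
    Skip
  | Store expr expr
  | Seq prog prog
  | Cond expr prog prog
  | While expr prog

text \<open>\<open>exec P m t m'\<close>: started in memory \<open>m\<close>, the program \<open>P\<close> halts after time \<open>t\<close> in memory \<open>m'\<close>.\<close>

inductive exec :: "prog \<Rightarrow> mem \<Rightarrow> nat \<Rightarrow> mem \<Rightarrow> bool" where
  Skip: "exec Skip m 1 m"
| Store: "exec (Store a e) m (cost a m + cost e m) (m(val a m := val e m))"
| Seq: "exec P m t m' \<Longrightarrow> exec Q m' u m'' \<Longrightarrow> exec (Seq P Q) m (t + u) m''"
| CondTrue: "val e m \<noteq> 0 \<Longrightarrow> exec P m t m' \<Longrightarrow> exec (Cond e P Q) m (cost e m + t) m'"
| CondFalse: "val e m = 0 \<Longrightarrow> exec Q m t m' \<Longrightarrow> exec (Cond e P Q) m (cost e m + t) m'"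
| WhileFalse: "val e m = 0 \<Longrightarrow> exec (While e P) m (cost e m) m"
| WhileTrue: "val e m \<noteq> 0 \<Longrightarrow> exec P m t m' \<Longrightarrow> exec (While e P) m' u m'' \<Longrightarrow>
    exec (While e P) m (cost e m + t + u) m''"

text \<open>The input is a list of numbers stored in the first memory cells, all other cells being \<open>0\<close>;
  the output is the number left in cell \<open>0\<close>.\<close>

definition input_mem :: "nat list \<Rightarrow> mem" where
  "input_mem xs = (\<lambda>i. if i < length xs then xs ! i else 0)"

definition computes_within :: "prog \<Rightarrow> nat list \<Rightarrow> nat \<Rightarrow> nat \<Rightarrow> bool" where
  "computes_within P xs y T \<longleftrightarrow> (\<exists>t m. exec P (input_mem xs) t m \<and> m 0 = y \<and> t \<le> T)"


section \<open>Counting induced scorpions\<close>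

fun binary_digits :: "nat \<Rightarrow> nat list" where
  "binary_digits k = (if k = 0 then [] else k mod 2 # binary_digits (k div 2))"

declare binary_digits.simps [simp del]

text \<open>
  A graph on the vertex set \<open>{..<n}\<close> is given by \<open>n\<close> and its adjacency matrix, row by row. The
  number \<open>k\<close> follows in binary, least significant digit first, one digit per cell; digits
  \<open>0\<close> and \<open>1\<close> are stored as \<open>1\<close> and \<open>2\<close>, so that the first empty cell marks the end. Since \<open>k\<close> is an
  arbitrary number while time is measured in \<open>n\<close> only, storing \<open>k\<close> in a single cell would be wrong: merely
  accessing that cell would cost \<open>log k\<close>, which is not bounded in \<open>n\<close>, and no algorithm would meet any
  time bound. Here \<open>k > n\<close> can be recognised after inspecting \<open>O(log n)\<close> cells.
\<close>

definition encode_graph :: "nat \<Rightarrow> (nat, 'b) pre_digraph \<Rightarrow> nat list" where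
  "encode_graph n G = n # [of_bool (u \<rightarrow>\<^bsub>G\<^esub> v). u \<leftarrow> [0..<n], v \<leftarrow> [0..<n]]"

definition counts_scorpions_in_time :: "nat \<Rightarrow> prog \<Rightarrow> (nat \<Rightarrow> nat) \<Rightarrow> bool" where
  "counts_scorpions_in_time l P T \<longleftrightarrow>
     (\<forall>n (G :: (nat, nat \<times> nat) pre_digraph) k.
        graph G \<and> verts G = {..<n} \<and> k \<ge> 1 \<longrightarrow>
        computes_within P (encode_graph n G @ map Suc (binary_digits k))
          (scorpion_count l G k) (T n))"


section \<open>The Strong Exponential-Time Hypothesis\<close>

text \<open>The literal \<open>(v, True)\<close> is the variable \<open>v\<close>, and \<open>(v, False)\<close> is its negation.\<close>

type_synonym literal = "nat \<times> bool"
type_synonym cnf = "literal list list"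

definition satisfiable :: "cnf \<Rightarrow> bool" where
  "satisfiable F \<longleftrightarrow> (\<exists>\<sigma> :: nat \<Rightarrow> bool. \<forall>C \<in> set F. \<exists>(v, p) \<in> set C. \<sigma> v = p)"

text \<open>
  Lists are used to fix the order in which clauses and literals are presented to the machine; a
  formula is a set of clauses and a clause is a set of at most \<open>q\<close> literals. Repetitions
  have to be excluded because the running time is measured in \<open>n\<close> only, so formulas of unbounded length
  could not even be read and SETH would hold trivially.
\<close>

definition is_cnf :: "nat \<Rightarrow> nat \<Rightarrow> cnf \<Rightarrow> bool" where
  "is_cnf q n F \<longleftrightarrow>
     distinct (map set F) \<and>
     (\<forall>C \<in> set F. distinct C \<and> length C \<le> q \<and> (\<forall>(v, p) \<in> set C. v < n))"

definition encode_cnf :: "nat \<Rightarrow> cnf \<Rightarrow> nat list" where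
  "encode_cnf n F =
     n # length F # concat (map (\<lambda>C. length C # map (\<lambda>(v, p). 2 * v + of_bool p) C) F)"

definition decides_sat_in_time :: "nat \<Rightarrow> prog \<Rightarrow> (nat \<Rightarrow> nat) \<Rightarrow> bool" where
  "decides_sat_in_time q P T \<longleftrightarrow>
     (\<forall>n F. is_cnf q n F \<longrightarrow>
        computes_within P (encode_cnf n F) (of_bool (satisfiable F)) (T n))"

definition SETH :: bool where
  "SETH \<longleftrightarrow>
     (\<forall>\<epsilon>::real. \<epsilon> > 0 \<longrightarrow>
        (\<exists>q\<ge>3. \<not> (\<exists>P T. decides_sat_in_time q P T \<and>
                     (\<lambda>n. real (T n)) \<in> O(\<lambda>n. 2 powr ((1 - \<epsilon>) * real n)))))"

end

theory Submission
  imports Defs "HOL-Real_Asymp.Real_Asymp"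
begin

text \<open>
  Let \<open>L = l + 2\<close>. Given a \<open>q\<close>-CNF formula, distribute its variables over \<open>L\<close> groups of about \<open>n / L\<close>
  variables and take one vertex for each of the \<open>A \<approx> 2\<^bsup>n/L\<^esup>\<close> assignments of each group. Consecutive
  groups are completely joined, and all groups but the first are cliques, so that a choice of one
  assignment per group is an induced path \<open>b, t\<^sub>1, \<dots>, t\<^sub>l, s\<close>. For a clause \<open>c\<close> and a position \<open>r\<close> in it there is
  a vertex standing for ``literal \<open>r\<close> is the first true literal of \<open>c\<close>'', which is a possible leg of the
  path if and only if the assignment makes this statement true; hence each satisfied clause contributes exactly one
  leg and each unsatisfied clause none. A further \<open>2A\<close> legs, forming a clique with the clause
  vertices, and an independent set of legs that outnumbers all other vertices force every scorpion
  with the maximum conceivable number of legs to have this shape. Thus a single value of the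
  scorpion count decides satisfiability. The graph has \<open>O(2\<^bsup>n/L\<^esup>)\<close> vertices, and its adjacency matrix,
  which has quadratic size, is written down within the time bound since \<open>L \<ge> 3\<close>.
\<close>

section \<open>Logarithmic cost\<close>

lemma less_exp_bit_length: "v < 2 ^ bit_length v"
  using floor_log_exp2_gt[of v] by (simp add: bit_length_def)

lemma bit_length_le:
  assumes "v < 2 ^ s" and "s \<ge> 1"
  shows "bit_length v \<le> s"
proof (cases "v = 0")
  case False
  then have "(2::nat) ^ floor_log v < 2 ^ s"
    using floor_log_exp2_le[of v] assms(1) by linarith
  then show ?thesis by (simp add: bit_length_def)
qed (use assms(2) in \<open>simp add: bit_length_def\<close>)

lemma bit_length_pos: "bit_length v \<ge> 1"
  by (simp add: bit_length_def)

lemma bit_length_add: "bit_length (x + y) \<le> bit_length x + bit_length y"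
proof (rule bit_length_le)
  \<comment> \<open>This says \<open>(2 ^ a - 1) * (2 ^ b - 1) \<ge> 0\<close>. The excess of 1 is
    harmless because \<open>x\<close> and \<open>y\<close> both lie strictly below their
    powers.\<close>
  have "(2::nat) ^ a + 2 ^ b \<le> 2 ^ (a + b) + 1" for a b :: nat
  proof -
    obtain c where c: "(2::nat)^a = Suc c" by (metis not0_implies_Suc power_not_zero zero_neq_numeral)
    obtain d where d: "(2::nat)^b = Suc d" by (metis not0_implies_Suc power_not_zero zero_neq_numeral)
    show ?thesis by (simp add: power_add c d)
  qed
  from this[of "bit_length x" "bit_length y"]
  show "x + y < 2 ^ (bit_length x + bit_length y)"
    using less_exp_bit_length[of x] less_exp_bit_length[of y] by linarith
qed (simp add: bit_length_def)

lemma bit_length_mult: "bit_length (x * y) \<le> bit_length x + bit_length y"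
proof (rule bit_length_le)
  show "x * y < 2 ^ (bit_length x + bit_length y)"
    by (auto simp: power_add intro!: mult_strict_mono less_exp_bit_length)
qed (simp add: bit_length_def)

section \<open>Cost of expressions over memories with short cells\<close>

text \<open>The number of cell lengths that a value can occupy, a constant once the expression is
  fixed. The crude rule for sums coincides with the one for products.\<close>

fun size_bound :: "expr \<Rightarrow> nat" where
  "size_bound (Num c) = Suc c"
| "size_bound (Mem e) = 1"
| "size_bound (Plus e f) = size_bound e + size_bound f"
| "size_bound (Minus e f) = size_bound e"
| "size_bound (Times e f) = size_bound e + size_bound f"
| "size_bound (Div e f) = size_bound e"

fun cost_bound :: "expr \<Rightarrow> nat" where
  "cost_bound (Num c) = size_bound (Num c)"
| "cost_bound (Mem e) = cost_bound e + size_bound (Mem e)"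
| "cost_bound (Plus e f) = cost_bound e + cost_bound f + size_bound (Plus e f)"
| "cost_bound (Minus e f) = cost_bound e + cost_bound f + size_bound (Minus e f)"
| "cost_bound (Times e f) = cost_bound e + cost_bound f + size_bound (Times e f)"
| "cost_bound (Div e f) = cost_bound e + cost_bound f + size_bound (Div e f)"

definition cells_bounded :: "nat \<Rightarrow> mem \<Rightarrow> bool" where
  "cells_bounded w m \<longleftrightarrow> w \<ge> 1 \<and> (\<forall>i. bit_length (m i) \<le> w)"

lemma bit_length_mono: "x \<le> y \<Longrightarrow> bit_length x \<le> bit_length y"
  by (simp add: bit_length_def floor_log_le_iff)

lemma bit_length_val:
  assumes "cells_bounded w m"
  shows "bit_length (val e m) \<le> w * size_bound e"
proof (induction e)
  case (Num c)
  have "bit_length c \<le> Suc c"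
    by (rule bit_length_le) (auto intro: less_trans[OF less_exp])
  also have "\<dots> \<le> w * Suc c"
    using assms mult_le_mono1[of 1 w "Suc c"] by (simp add: cells_bounded_def)
  finally show ?case by simp
next
  case (Mem e)
  then show ?case using assms by (simp add: cells_bounded_def)
next
  case (Plus e f)
  then show ?case
    using bit_length_add[of "val e m" "val f m"] by (simp add: algebra_simps)
next
  case (Minus e f)
  then show ?case
    using bit_length_mono[of "val e m - val f m" "val e m"] by simp
next
  case (Times e f)
  then show ?case
    using bit_length_mult[of "val e m" "val f m"] by (simp add: algebra_simps)
next
  case (Div e f)
  then show ?case
    using bit_length_mono[of "val e m div val f m" "val e m"] by simp
qed

lemma cost_le:
  assumes "cells_bounded w m"
  shows "cost e m \<le> w * cost_bound e"
proof (induction e)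
  case (Mem e)
  then show ?case using bit_length_val[OF assms, of "Mem e"] by (simp add: algebra_simps)
next
  case (Num c)
  then show ?case using bit_length_val[OF assms, of "Num c"] by simp
next
  case (Plus e f)
  then show ?case using bit_length_val[OF assms, of "Plus e f"] by (simp add: algebra_simps)
next
  case (Minus e f)
  then show ?case using bit_length_val[OF assms, of "Minus e f"] by (simp add: algebra_simps)
next
  case (Times e f)
  then show ?case using bit_length_val[OF assms, of "Times e f"] by (simp add: algebra_simps)
next
  case (Div e f)
  then show ?case using bit_length_val[OF assms, of "Div e f"] by (simp add: algebra_simps)
qed

section \<open>Composition of programs with upper bounds on time\<close>

definition halts_within :: "prog \<Rightarrow> mem \<Rightarrow> nat \<Rightarrow> mem \<Rightarrow> bool" where
  "halts_within P m T m' \<longleftrightarrow> (\<exists>t\<le>T. exec P m t m')"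

lemma halts_within_Store:
  assumes "cells_bounded w m" and "m' = m(val a m := val e m)"
    and "T \<ge> w * (cost_bound a + cost_bound e)"
  shows "halts_within (Store a e) m T m'"
  unfolding halts_within_def assms(2)
  using exec.Store[of a e m] cost_le[OF assms(1), of a] cost_le[OF assms(1), of e] assms(3)
  by (intro exI[of _ "cost a m + cost e m"]) (auto simp: algebra_simps)

lemma halts_within_Seq:
  assumes "halts_within P m T m'" and "halts_within Q m' U m''"
  shows "halts_within (Seq P Q) m (T + U) m''"
  using assms unfolding halts_within_def by (meson add_mono exec.Seq)

lemma halts_within_mono:
  assumes "halts_within P m T m'" and "T \<le> U"
  shows "halts_within P m U m'"
  using assms unfolding halts_within_def by (meson order_trans)

text \<open>The loop is described by the sequence \<open>s\<close> of memories between passes. There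
  are \<open>K\<close> passes and \<open>K + 1\<close> tests; charging a pass to every test keeps
  the bound a single product.\<close>

lemma halts_within_While:
  assumes "\<And>i. i < K \<Longrightarrow> val e (s i) \<noteq> 0" and "val e (s K) = 0"
    and "\<And>i. i \<le> K \<Longrightarrow> cost e (s i) \<le> T"
    and "\<And>i. i < K \<Longrightarrow> halts_within P (s i) U (s (Suc i))"
  shows "halts_within (While e P) (s 0) (Suc K * (T + U)) (s K)"
  using assms
proof (induction K arbitrary: s)
  case 0
  then show ?case
    unfolding halts_within_def
    by (intro exI[of _ "cost e (s 0)"]) (auto intro: exec.WhileFalse trans_le_add1)
next
  case (Suc K)
  have "halts_within (While e P) (s (Suc 0)) (Suc K * (T + U)) (s (Suc K))"
    using Suc.prems by (intro Suc.IH[of "\<lambda>i. s (Suc i)"]) auto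
  then obtain u where u: "u \<le> Suc K * (T + U)" "exec (While e P) (s (Suc 0)) u (s (Suc K))"
    unfolding halts_within_def by blast
  from Suc.prems(4)[of 0] obtain t where t: "t \<le> U" "exec P (s 0) t (s (Suc 0))"
    unfolding halts_within_def by auto
  have "exec (While e P) (s 0) (cost e (s 0) + t + u) (s (Suc K))"
    using Suc.prems(1)[of 0] t(2) u(2) by (intro exec.WhileTrue) auto
  moreover have "cost e (s 0) + t + u \<le> Suc (Suc K) * (T + U)"
    using Suc.prems(3)[of 0] t(1) u(1) by simp
  ultimately show ?case unfolding halts_within_def by blast
qed

section \<open>Programs on interleaved arrays\<close>

definition upd :: "(nat \<Rightarrow> nat \<Rightarrow> nat) \<Rightarrow> nat \<Rightarrow> nat \<Rightarrow> nat \<Rightarrow> (nat \<Rightarrow> nat \<Rightarrow> nat)" where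
  "upd arr j i v = arr(j := (arr j)(i := v))"

text \<open>
  The number of clauses is in cell \<open>1\<close> of the input \<open>I\<close>, so \<open>origin q I\<close> bounds the input length. The
  remaining cells are split into five interleaved infinite arrays: \<open>0\<close> holds a loop counter in its
  first cell, \<open>1\<close> to \<open>3\<close> are tables, and \<open>4\<close> is the memory of the simulated program, which is thus free
  of scratch data when the simulation starts.
\<close>

definition origin :: "nat \<Rightarrow> mem \<Rightarrow> nat" where
  "origin q I = 2 + (q + 1) * I 1"

definition layout :: "nat \<Rightarrow> mem \<Rightarrow> (nat \<Rightarrow> nat \<Rightarrow> nat) \<Rightarrow> mem" where
  "layout q I arr x = (let W = origin q I in
     if x < W then I x else arr ((x - W) mod 5) ((x - W) div 5))"

text \<open>The offset depends on the number of clauses and is no constant of the program: every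
  access recomputes it from cell \<open>1\<close>, which is never overwritten.\<close>

definition originE :: "nat \<Rightarrow> expr" where
  "originE q = Plus (Num 2) (Times (Num (q + 1)) (Mem (Num 1)))"

definition addr :: "nat \<Rightarrow> nat \<Rightarrow> expr \<Rightarrow> expr" where
  "addr q j e = Plus (originE q) (Plus (Num j) (Times (Num 5) e))"

definition Cell :: "nat \<Rightarrow> nat \<Rightarrow> expr \<Rightarrow> expr" where
  "Cell q j e = Mem (addr q j e)"

lemma layout_input [simp]: "x < origin q I \<Longrightarrow> layout q I arr x = I x"
  by (simp add: layout_def)

lemma layout_0 [simp]: "layout q I arr 0 = I 0"
  and layout_1 [simp]: "layout q I arr (Suc 0) = I (Suc 0)"
  by (simp_all add: origin_def)

lemma layout_array [simp]: "j < 5 \<Longrightarrow> layout q I arr (origin q I + (j + 5 * i)) = arr j i"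
  by (simp add: layout_def)

lemma val_originE [simp]: "val (originE q) (layout q I arr) = origin q I"
  by (simp add: originE_def origin_def)

lemma val_addr [simp]:
  "val (addr q j e) (layout q I arr) = origin q I + (j + 5 * val e (layout q I arr))"
  by (simp add: addr_def)

lemma val_Cell [simp]:
  "j < 5 \<Longrightarrow> val (Cell q j e) (layout q I arr) = arr j (val e (layout q I arr))"
  by (simp add: Cell_def)

lemma layout_upd:
  assumes "j < 5"
  shows "(layout q I arr)(origin q I + (j + 5 * i) := v) = layout q I (upd arr j i v)"
proof
  fix x
  show "((layout q I arr)(origin q I + (j + 5 * i) := v)) x = layout q I (upd arr j i v) x"
  proof (cases "x < origin q I")
    case False
    then obtain y where x: "x = origin q I + y" using le_Suc_ex not_less by blast
    show ?thesis
    proof (cases "y = j + 5 * i")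
      case True
      with assms show ?thesis by (simp add: x layout_def upd_def)
    next
      case False
      then have "y mod 5 \<noteq> j \<or> y div 5 \<noteq> i"
        using mult_div_mod_eq[of 5 y] by fastforce
      with False show ?thesis by (auto simp: x layout_def upd_def)
    qed
  qed auto
qed

lemma cells_bounded_layout:
  assumes "\<And>x. bit_length (I x) \<le> w" and "\<And>j i. j < 5 \<Longrightarrow> bit_length (arr j i) \<le> w"
  shows "cells_bounded w (layout q I arr)"
  using assms order_trans[OF bit_length_pos assms(1)[of 0]]
  by (auto simp: cells_bounded_def layout_def Let_def)

section \<open>Simulation of a program inside one array\<close>

fun trans_expr :: "nat \<Rightarrow> expr \<Rightarrow> expr" where
  "trans_expr q (Num c) = Num c"
| "trans_expr q (Mem e) = Cell q 4 (trans_expr q e)"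
| "trans_expr q (Plus e f) = Plus (trans_expr q e) (trans_expr q f)"
| "trans_expr q (Minus e f) = Minus (trans_expr q e) (trans_expr q f)"
| "trans_expr q (Times e f) = Times (trans_expr q e) (trans_expr q f)"
| "trans_expr q (Div e f) = Div (trans_expr q e) (trans_expr q f)"

fun trans_prog :: "nat \<Rightarrow> prog \<Rightarrow> prog" where
  "trans_prog q Skip = Skip"
| "trans_prog q (Store a e) = Store (addr q 4 (trans_expr q a)) (trans_expr q e)"
| "trans_prog q (Seq P Q) = Seq (trans_prog q P) (trans_prog q Q)"
| "trans_prog q (Cond e P Q) = Cond (trans_expr q e) (trans_prog q P) (trans_prog q Q)"
| "trans_prog q (While e P) = While (trans_expr q e) (trans_prog q P)"

lemma val_trans_expr [simp]: "val (trans_expr q e) (layout q I arr) = val e (arr 4)"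
  by (induction e) auto

definition overhead :: "nat \<Rightarrow> nat" where
  "overhead q = 5 * q + 60"

lemma bit_length_le_Suc: "bit_length c \<le> Suc c"
  by (rule bit_length_le) (auto intro: less_trans[OF less_exp])

lemma bit_length_numerals: "bit_length (Suc 0) = 1" "bit_length 2 = 2" "bit_length 4 = 3" "bit_length 5 = 3"
  by (simp_all add: bit_length_def floor_log_rec)

text \<open>The index enters three intermediate results (scaled, shifted, added to the origin),
  hence the factor 3. The summand 3 on the left is slack for \<open>mult_excess\<close>.\<close>

lemma cost_addr:
  assumes "bit_length (I 1) \<le> w"
  shows "cost (addr q 4 e) (layout q I arr) + 3
    \<le> cost e (layout q I arr) + 3 * bit_length (val e (layout q I arr)) + w * overhead q"
proof -
  let ?v = "val e (layout q I arr)" and ?o = "origin q I"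
  have w: "w \<ge> 1" using assms bit_length_pos[of "I 1"] by linarith
  have q: "bit_length (q + 1) \<le> q + 2"
    using bit_length_le_Suc[of "q + 1"] by simp
  have p: "bit_length ((q + 1) * I 1) \<le> q + 2 + w"
    using bit_length_mult[of "q + 1" "I 1"] q assms by linarith
  have o: "bit_length ?o \<le> q + 4 + w"
    using bit_length_add[of 2 "(q + 1) * I 1"] p by (simp add: origin_def bit_length_numerals)
  have v1: "bit_length (5 * ?v) \<le> 3 + bit_length ?v"
    using bit_length_mult[of 5 ?v] by (simp add: bit_length_numerals)
  have v2: "bit_length (4 + 5 * ?v) \<le> 6 + bit_length ?v"
    using bit_length_add[of 4 "5 * ?v"] v1 by (simp add: bit_length_numerals)
  have v3: "bit_length (?o + (4 + 5 * ?v)) \<le> q + 10 + w + bit_length ?v"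
    using bit_length_add[of ?o "4 + 5 * ?v"] v2 o by simp
  have c: "cost (originE q) (layout q I arr) \<le> 3 * q + 12 + 3 * w"
    using q p o assms by (simp add: originE_def origin_def bit_length_numerals)
  have "cost (addr q 4 e) (layout q I arr) + 3
      \<le> cost e (layout q I arr) + 3 * bit_length ?v + (4 * q + 40 + 4 * w)"
    using c v1 v2 v3 by (simp add: addr_def bit_length_numerals)
  also have "4 * q + 40 + 4 * w \<le> w * overhead q"
    using mult_le_mono1[OF w, of "4 * q + 40"] by (simp add: overhead_def algebra_simps)
  finally show ?thesis by simp
qed

text \<open>Equivalent to \<open>(K - 3) * (v - 1) \<ge> 0\<close>; it lets a saved amount
  \<open>K * v\<close> pay for an address computation.\<close>

lemma mult_excess:
  fixes K v :: nat
  assumes "K \<ge> 3" and "v \<ge> 1"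
  shows "3 * v + K \<le> K * v + 3"
proof -
  obtain a b where "K = 3 + a" "v = Suc b"
    using assms by (metis One_nat_def Suc_le_D le_Suc_ex)
  then show ?thesis by simp
qed

text \<open>An access to an array cell costs more than the bit length of its contents, namely a multiple of
  the bit length of the index. The second summand on the left saves up for this, so that the
  induction passes through nested accesses.\<close>

lemma cost_trans_expr_aux:
  assumes "bit_length (I 1) \<le> w" and "K = w * overhead q"
  shows "cost (trans_expr q e) (layout q I arr) + K * bit_length (val e (arr 4))
    \<le> 2 * K * cost e (arr 4)"
proof -
  have w: "w \<ge> 1" using assms bit_length_pos[of "I 1"] by linarith
  have K: "K \<ge> w * (5 * q) + 60"
    using w by (simp add: assms(2) overhead_def algebra_simps)
  have "x \<le> K * x" for x using K by simp
  note * = this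
  obtain d where d: "K = Suc d" using K by (cases K) auto
  show ?thesis
  proof (induction e)
    case (Num c)
    then show ?case by (simp add: d)
  next
    case (Mem e)
    define v v' where "v = bit_length (val e (arr 4))" and "v' = bit_length (arr 4 (val e (arr 4)))"
    have 1: "cost (addr q 4 (trans_expr q e)) (layout q I arr) + 3
        \<le> cost (trans_expr q e) (layout q I arr) + 3 * v + K"
      using cost_addr[of I w q "trans_expr q e" arr, OF assms(1)] by (simp add: v_def assms(2))
    have v1: "v \<ge> 1" "v' \<ge> 1" unfolding v_def v'_def by (rule bit_length_pos)+
    have 2: "3 * v + K + v' \<le> K * v + K * v' + 3"
      using mult_excess[of K v] *[of v'] K v1 by linarith
    have "cost (trans_expr q (Mem e)) (layout q I arr)
        = cost (addr q 4 (trans_expr q e)) (layout q I arr) + v'"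
      by (simp add: Cell_def v'_def)
    then show ?case using 1 2 Mem
      by (simp add: v_def[symmetric] v'_def[symmetric] algebra_simps)
  next
    case (Plus e f)
    then show ?case by (simp add: d algebra_simps)
  next
    case (Minus e f)
    then show ?case by (simp add: d algebra_simps)
  next
    case (Times e f)
    then show ?case by (simp add: d algebra_simps)
  next
    case (Div e f)
    then show ?case by (simp add: d algebra_simps)
  qed
qed

lemma cost_trans_expr:
  assumes "bit_length (I 1) \<le> w"
  shows "cost (trans_expr q e) (layout q I arr) \<le> 2 * (w * overhead q) * cost e (arr 4)"
  using cost_trans_expr_aux[of I w _ q e arr, OF assms refl] by simp

lemma cost_addr_trans_expr:
  assumes "bit_length (I 1) \<le> w"
  shows "cost (addr q 4 (trans_expr q e)) (layout q I arr) \<le> 2 * (w * overhead q) * cost e (arr 4)"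
proof -
  have "w \<ge> 1" using assms bit_length_pos[of "I 1"] by linarith
  then have "3 \<le> w * overhead q" by (simp add: overhead_def mult_le_mono[of 1 w 3, simplified])
  then show ?thesis
    using cost_trans_expr_aux[of I w _ q e arr, OF assms refl]
      cost_addr[of I w q "trans_expr q e" arr, OF assms]
      mult_excess[OF _ bit_length_pos, of "w * overhead q" "val e (arr 4)"]
    by simp
qed

text \<open>Each evaluation in \<open>P\<close> is matched by one in its translation, dearer by a
  common factor. Only the array with the simulated memory is tracked through the induction, whence
  the existential \<open>arr'\<close>.\<close>

lemma exec_trans_prog:
  assumes "exec P m t m'" and "arr 4 = m" and "bit_length (I 1) \<le> w"
  shows "\<exists>arr'. arr' 4 = m' \<and>
    halts_within (trans_prog q P) (layout q I arr) (2 * (w * overhead q) * t) (layout q I arr')"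
  using assms(1,2)
proof (induction arbitrary: arr rule: exec.induct)
  case (Skip m)
  have "w \<ge> 1" using assms(3) bit_length_pos[of "I 1"] by linarith
  then have "1 \<le> 2 * (w * overhead q) * 1" by (simp add: overhead_def)
  then show ?case using Skip unfolding halts_within_def
    by (metis exec.Skip trans_prog.simps(1))
next
  case (Store a e m)
  show ?case
  proof (intro exI[of _ "upd arr 4 (val a m) (val e m)"] conjI)
    show "(upd arr 4 (val a m) (val e m)) 4 = m(val a m := val e m)"
      using Store by (simp add: upd_def)
    have "exec (trans_prog q (Store a e)) (layout q I arr)
       (cost (addr q 4 (trans_expr q a)) (layout q I arr) + cost (trans_expr q e) (layout q I arr))
       (layout q I (upd arr 4 (val a m) (val e m)))"
      using exec.Store[of "addr q 4 (trans_expr q a)" "trans_expr q e" "layout q I arr"] Store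
      by (simp add: layout_upd)
    then show "halts_within (trans_prog q (Store a e)) (layout q I arr)
       (2 * (w * overhead q) * (cost a m + cost e m)) (layout q I (upd arr 4 (val a m) (val e m)))"
      using cost_addr_trans_expr[of I w q a arr, OF assms(3)]
        cost_trans_expr[of I w q e arr, OF assms(3)] Store
      unfolding halts_within_def
      by (intro exI[of _ "cost (addr q 4 (trans_expr q a)) (layout q I arr)
        + cost (trans_expr q e) (layout q I arr)"]) (simp add: algebra_simps)
  qed
next
  case (Seq P m t m' Q u m'')
  obtain arr' where 1: "arr' 4 = m'"
    "halts_within (trans_prog q P) (layout q I arr) (2 * (w * overhead q) * t) (layout q I arr')"
    using Seq by blast
  obtain arr'' where 2: "arr'' 4 = m''"
    "halts_within (trans_prog q Q) (layout q I arr') (2 * (w * overhead q) * u) (layout q I arr'')"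
    using Seq 1 by blast
  show ?case using 2(1) halts_within_Seq[OF 1(2) 2(2)]
    by (auto simp: distrib_left)
next
  case (CondTrue e m P t m' Q)
  obtain arr' t' where 1: "arr' 4 = m'" "t' \<le> 2 * (w * overhead q) * t"
    "exec (trans_prog q P) (layout q I arr) t' (layout q I arr')"
    using CondTrue unfolding halts_within_def by blast
  have "exec (trans_prog q (Cond e P Q)) (layout q I arr)
      (cost (trans_expr q e) (layout q I arr) + t') (layout q I arr')"
    using CondTrue 1 by (auto intro: exec.CondTrue)
  then show ?case using 1(1,2) cost_trans_expr[of I w q e arr, OF assms(3)] CondTrue
    unfolding halts_within_def distrib_left by (blast intro: add_mono)
next
  case (CondFalse e m Q t m' P)
  obtain arr' t' where 1: "arr' 4 = m'" "t' \<le> 2 * (w * overhead q) * t"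
    "exec (trans_prog q Q) (layout q I arr) t' (layout q I arr')"
    using CondFalse unfolding halts_within_def by blast
  have "exec (trans_prog q (Cond e P Q)) (layout q I arr)
      (cost (trans_expr q e) (layout q I arr) + t') (layout q I arr')"
    using CondFalse 1 by (auto intro: exec.CondFalse)
  then show ?case using 1(1,2) cost_trans_expr[of I w q e arr, OF assms(3)] CondFalse
    unfolding halts_within_def distrib_left by (blast intro: add_mono)
next
  case (WhileFalse e m P)
  have "exec (trans_prog q (While e P)) (layout q I arr)
      (cost (trans_expr q e) (layout q I arr)) (layout q I arr)"
    using WhileFalse by (auto intro: exec.WhileFalse)
  then show ?case using cost_trans_expr[of I w q e arr, OF assms(3)] WhileFalse
    unfolding halts_within_def by blast
next
  case (WhileTrue e m P t m' u m'')
  obtain arr' t' where 1: "arr' 4 = m'" "t' \<le> 2 * (w * overhead q) * t"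
    "exec (trans_prog q P) (layout q I arr) t' (layout q I arr')"
    using WhileTrue unfolding halts_within_def by blast
  obtain arr'' u' where 2: "arr'' 4 = m''" "u' \<le> 2 * (w * overhead q) * u"
    "exec (trans_prog q (While e P)) (layout q I arr') u' (layout q I arr'')"
    using WhileTrue 1 unfolding halts_within_def by blast
  have "exec (trans_prog q (While e P)) (layout q I arr)
      (cost (trans_expr q e) (layout q I arr) + t' + u') (layout q I arr'')"
    using WhileTrue 1 2 by (auto intro: exec.WhileTrue)
  then show ?case using 1(2) 2(1,2) cost_trans_expr[of I w q e arr, OF assms(3)] WhileTrue
    unfolding halts_within_def distrib_left by (blast intro: add_mono)
qed

section \<open>Tabulating a sequence by a loop\<close>

abbreviation cnt :: "nat \<Rightarrow> expr" where
  "cnt q \<equiv> Cell q 0 (Num 0)"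

definition set_cnt :: "nat \<Rightarrow> expr \<Rightarrow> prog" where
  "set_cnt q e = Store (addr q 0 (Num 0)) e"

definition fill_body :: "nat \<Rightarrow> nat \<Rightarrow> expr \<Rightarrow> prog" where
  "fill_body q j e = Seq (Store (addr q j (Plus (cnt q) (Num 1))) e) (set_cnt q (Plus (cnt q) (Num 1)))"

text \<open>A pass with counter \<open>i\<close> writes entry \<open>i + 1\<close>, so
  \<open>e\<close> may refer to entry \<open>i\<close> and recursions can be tabulated. The final
  reset of the counter prepares the next loop.\<close>

definition fill :: "nat \<Rightarrow> nat \<Rightarrow> expr \<Rightarrow> expr \<Rightarrow> expr \<Rightarrow> prog" where
  "fill q j init bound e =
     Seq (Store (addr q j (Num 0)) init)
       (Seq (While (Minus bound (cnt q)) (fill_body q j e)) (set_cnt q (Num 0)))"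

definition fill_const :: "nat \<Rightarrow> nat \<Rightarrow> expr \<Rightarrow> expr \<Rightarrow> expr \<Rightarrow> nat" where
  "fill_const q j init bound e =
     (cost_bound (addr q j (Num 0)) + cost_bound init) +
     (cost_bound (Minus bound (cnt q)) +
       (cost_bound (addr q j (Plus (cnt q) (Num 1))) + cost_bound e +
        (cost_bound (addr q 0 (Num 0)) + cost_bound (Plus (cnt q) (Num 1))))) +
     (cost_bound (addr q 0 (Num 0)) + cost_bound (Num 0))"

text \<open>Entries not yet reached are 0 as in the untouched array, so the memory during a loop is
  a function of the number of passes.\<close>

definition filled :: "(nat \<Rightarrow> nat) \<Rightarrow> nat \<Rightarrow> nat \<Rightarrow> nat" where
  "filled f i = (\<lambda>x. if x \<le> i then f x else 0)"

text \<open>\<open>st i\<close> is the memory after \<open>i\<close> passes. The loop bound is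
  re-evaluated at each test, so it has to yield \<open>K\<close> in all these memories.\<close>

lemma halts_within_fill:
  fixes q I arr j f
  defines "st \<equiv> \<lambda>i. layout q I (upd (arr(j := filled f i)) 0 0 i)"
  assumes j: "0 < j" "j < 5"
    and arr: "arr j = (\<lambda>_. 0)" "arr 0 0 = 0"
    and init: "val init (layout q I arr) = f 0"
    and bound: "\<And>i. i \<le> K \<Longrightarrow> val bound (st i) = K"
    and step: "\<And>i. i < K \<Longrightarrow> val e (st i) = f (Suc i)"
    and I: "\<And>x. bit_length (I x) \<le> w"
    and arr_le: "\<And>j i. j < 5 \<Longrightarrow> bit_length (arr j i) \<le> w"
    and f: "\<And>i. i \<le> K \<Longrightarrow> bit_length (f i) \<le> w" and K: "bit_length K \<le> w"
  shows "halts_within (fill q j init bound e) (layout q I arr)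
    (w * fill_const q j init bound e * Suc K) (layout q I (arr(j := filled f K)))"
proof -
  have w: "w \<ge> 1" using order_trans[OF bit_length_pos I[of 0]] .
  have z: "bit_length 0 \<le> w" using w by (simp add: bit_length_def)
  have b0: "cells_bounded w (layout q I arr)"
    by (rule cells_bounded_layout) (auto intro: I arr_le)
  have bst: "cells_bounded w (st i)" if "i \<le> K" for i
    unfolding st_def
    using that order_trans[OF bit_length_mono K]
    by (intro cells_bounded_layout) (auto intro: I arr_le f z simp: filled_def upd_def)
  \<comment> \<open>The memory in the middle of a pass: the entry is written, the counter not yet
    advanced.\<close>
  let ?st' = "\<lambda>i. layout q I (upd (arr(j := filled f (Suc i))) 0 0 i)"
  have bst': "cells_bounded w (?st' i)" if "i < K" for i
    using that order_trans[OF bit_length_mono K]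
    by (intro cells_bounded_layout) (auto intro: I arr_le f z simp: filled_def upd_def)
  have 1: "halts_within (Store (addr q j (Num 0)) init) (layout q I arr)
      (w * (cost_bound (addr q j (Num 0)) + cost_bound init)) (st 0)"
  proof (rule halts_within_Store[OF b0])
    have "upd arr j 0 (f 0) = upd (arr(j := filled f 0)) 0 0 0"
      using arr j by (auto simp: fun_eq_iff upd_def filled_def)
    then show "st 0 = (layout q I arr)(val (addr q j (Num 0)) (layout q I arr) := val init (layout q I arr))"
      using j layout_upd[of j q I arr 0] by (simp add: st_def init)
  qed auto
  have body: "halts_within (fill_body q j e) (st i)
      (w * (cost_bound (addr q j (Plus (cnt q) (Num 1))) + cost_bound e) +
       w * (cost_bound (addr q 0 (Num 0)) + cost_bound (Plus (cnt q) (Num 1)))) (st (Suc i))"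
    if i: "i < K" for i
    unfolding fill_body_def set_cnt_def
  proof (rule halts_within_Seq)
    have "upd (upd (arr(j := filled f i)) 0 0 i) j (Suc i) (f (Suc i))
        = upd (arr(j := filled f (Suc i))) 0 0 i"
      using j by (auto simp: fun_eq_iff upd_def filled_def le_Suc_eq)
    then show "halts_within (Store (addr q j (Plus (cnt q) (Num 1))) e) (st i)
      (w * (cost_bound (addr q j (Plus (cnt q) (Num 1))) + cost_bound e)) (?st' i)"
      using j i step[OF i] layout_upd[of j q I "upd (arr(j := filled f i)) 0 0 i" "Suc i"]
      by (intro halts_within_Store[OF bst]) (simp_all add: st_def upd_def)
    have "upd (upd (arr(j := filled f (Suc i))) 0 0 i) 0 0 (Suc i)
        = upd (arr(j := filled f (Suc i))) 0 0 (Suc i)"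
      by (auto simp: fun_eq_iff upd_def)
    then show "halts_within (Store (addr q 0 (Num 0)) (Plus (cnt q) (Num 1))) (?st' i)
       (w * (cost_bound (addr q 0 (Num 0)) + cost_bound (Plus (cnt q) (Num 1)))) (st (Suc i))"
      using i layout_upd[of 0 q I "upd (arr(j := filled f (Suc i))) 0 0 i" 0]
      by (intro halts_within_Store[OF bst']) (simp_all add: st_def upd_def)
  qed
  have 2: "halts_within (While (Minus bound (cnt q)) (fill_body q j e)) (st 0)
      (Suc K * (w * cost_bound (Minus bound (cnt q)) +
       (w * (cost_bound (addr q j (Plus (cnt q) (Num 1))) + cost_bound e) +
       w * (cost_bound (addr q 0 (Num 0)) + cost_bound (Plus (cnt q) (Num 1)))))) (st K)"
  proof (rule halts_within_While[where s = st])
    have "val (cnt q) (st i) = i" for i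
      using j by (simp add: st_def upd_def)
    then show "i < K \<Longrightarrow> val (Minus bound (cnt q)) (st i) \<noteq> 0" "val (Minus bound (cnt q)) (st K) = 0" for i
      using bound by simp_all
  qed (use body cost_le[OF bst] in \<open>blast+\<close>)
  have 3: "halts_within (set_cnt q (Num 0)) (st K)
     (w * (cost_bound (addr q 0 (Num 0)) + cost_bound (Num 0))) (layout q I (arr(j := filled f K)))"
    unfolding set_cnt_def
  proof (rule halts_within_Store[OF bst])
    have "upd (upd (arr(j := filled f K)) 0 0 K) 0 0 0 = arr(j := filled f K)"
      using j arr by (auto simp: fun_eq_iff upd_def)
    then show "layout q I (arr(j := filled f K)) = (st K)
      (val (addr q 0 (Num 0)) (st K) := val (Num 0) (st K))"
      using layout_upd[of 0 q I "upd (arr(j := filled f K)) 0 0 K" 0 0] by (simp add: st_def)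
  qed auto
  show ?thesis
    unfolding fill_def
    by (rule halts_within_mono[OF halts_within_Seq[OF 1 halts_within_Seq[OF 2 3]]])
      (auto simp: fill_const_def algebra_simps)
qed

section \<open>The graph of a formula\<close>

definition simple_graph :: "nat \<Rightarrow> (nat \<Rightarrow> nat \<Rightarrow> bool) \<Rightarrow> (nat, nat \<times> nat) pre_digraph" where
  "simple_graph N R = \<lparr>verts = {..<N}, arcs = {(u, v). u < N \<and> v < N \<and> R u v}, tail = fst, head = snd\<rparr>"

lemma verts_simple_graph [simp]: "verts (simple_graph N R) = {..<N}"
  by (simp add: simple_graph_def)

lemma simple_graph_adj [simp]: "u \<rightarrow>\<^bsub>simple_graph N R\<^esub> v \<longleftrightarrow> u < N \<and> v < N \<and> R u v"
  by (force simp: simple_graph_def arcs_ends_def arc_to_ends_def)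

lemma simple_graph_induce_adj:
  "u \<rightarrow>\<^bsub>simple_graph N R \<restriction> X\<^esub> v \<longleftrightarrow> u \<in> X \<and> v \<in> X \<and> u < N \<and> v < N \<and> R u v"
  by (force simp: simple_graph_def induce_subgraph_def arcs_ends_def arc_to_ends_def)

lemma graphI:
  assumes "finite (verts H)" and "arcs H \<subseteq> verts H \<times> verts H" and "tail H = fst" and "head H = snd"
    and "\<And>u v. (u, v) \<in> arcs H \<Longrightarrow> (v, u) \<in> arcs H \<and> u \<noteq> v"
  shows "graph H"
proof -
  have fin: "finite (arcs H)"
    using assms(1,2) by (meson finite_SigmaI finite_subset)
  have "symmetric H"
    using assms(5) by (force simp: symmetric_def sym_def arcs_ends_def arc_to_ends_def assms(3,4))
  with fin show ?thesis
    using assms by unfold_locales (auto simp: arc_to_ends_def)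
qed

lemma graph_simple_graph:
  assumes "symp R" and "irreflp R"
  shows "graph (simple_graph N R)" and "finite X \<Longrightarrow> graph (simple_graph N R \<restriction> X)"
  using assms
  by (auto intro!: graphI simp: simple_graph_def induce_subgraph_def irreflp_on_def elim: sympE)

text \<open>The induction splits off the lowest digit. Reading digits as truth values, the numbers
  below \<open>2 ^ h\<close> thus list all assignments of a group.\<close>

lemma ex_digits:
  "\<exists>a::nat. a < 2 ^ h \<and> (\<forall>y < h. odd (a div 2 ^ y) = f y)"
proof (induction h arbitrary: f)
  case (Suc h)
  from Suc[of "\<lambda>y. f (Suc y)"] obtain a :: nat where
    a: "a < 2 ^ h" "\<forall>y < h. odd (a div 2 ^ y) = f (Suc y)" by blast
  have "odd ((2 * a + of_bool (f 0)) div 2 ^ y) = f y" if "y < Suc h" for y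
    using that a(2) by (cases y) (auto simp: div_mult2_eq)
  moreover have "2 * a + of_bool (f 0) < 2 ^ Suc h" using a(1) by (cases "f 0") auto
  ultimately show ?case by blast
qed auto

text \<open>\<open>Asg g a\<close> is the assignment \<open>a\<close> of group \<open>g\<close>, \<open>Lit c r\<close> says that literal \<open>r\<close> is the first true one of
  clause \<open>c\<close>, \<open>Clq\<close> and \<open>Ind\<close> are the additional legs. Each clause has \<open>q\<close> slots, those beyond its length
  being isolated vertices \<open>Iso\<close>.\<close>

datatype kind = Asg nat nat | Clq | Lit nat nat | Ind | Iso

section \<open>The reduction graph\<close>

locale reduction =
  fixes l q n :: nat and F :: cnf
  assumes cnf: "is_cnf q n F" and q: "q \<ge> 1" and l: "l \<ge> 1"
begin

definition "L = l + 2"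
text \<open>Variable \<open>v\<close> belongs to group \<open>v mod L\<close> and is digit
  \<open>v div L\<close> of its assignment; the summand 1 makes all these digit positions less than
  \<open>h\<close>.\<close>

definition "h = n div L + 1"
definition "A = (2::nat) ^ h"
definition "m = length F"
text \<open>The number of vertices outside the independent set: \<open>L * A\<close> assignments,
  \<open>2 * A\<close> clique legs and \<open>q\<close> slots per clause. The independent set gets
  one more.\<close>

definition "E = (L + 2) * A + q * m"
definition "N = 2 * E + 1"
text \<open>The path, all independent and clique legs, and one leg per clause.\<close>

definition "K = L + (E + 1) + 2 * A + m"

definition kind :: "nat \<Rightarrow> kind" where
  "kind u =
    (if u < L * A then Asg (u div A) (u mod A)
     else if u < (L + 2) * A then Clq
     else if u < E then
       (let x = u - (L + 2) * A in
        if x mod q < length (F ! (x div q)) then Lit (x div q) (x mod q) else Iso)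
     else Ind)"

definition lit_true :: "nat \<Rightarrow> literal \<Rightarrow> bool" where
  "lit_true a lt = (odd (a div 2 ^ (fst lt div L)) = snd lt)"

text \<open>Assignment \<open>a\<close> of group \<open>g\<close> refutes that literal
  \<open>r\<close> is the first true one of clause \<open>c\<close>. A group tests only its own
  literals, so the claim is true iff no group refutes it.\<close>

definition mismatch :: "nat \<Rightarrow> nat \<Rightarrow> nat \<Rightarrow> nat \<Rightarrow> bool" where
  "mismatch g a c r \<longleftrightarrow> (\<exists>r'\<le>r. fst (F ! c ! r') mod L = g \<and> lit_true a (F ! c ! r') \<noteq> (r' = r))"

text \<open>The path vertex in group 0 plays \<open>b\<close> and must see the legs, the others must
  not. With the condition negated for \<open>g = 0\<close>, a clause vertex is a possible leg iff no
  group has a mismatch. Group 0 is no clique, so none of its vertices is a leg of another.\<close>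

fun link :: "kind \<Rightarrow> kind \<Rightarrow> bool" where
  "link (Asg g a) (Asg g' a') = (g' = Suc g \<or> g = Suc g' \<or> g = g' \<and> g \<ge> 1)"
| "link (Asg g a) Clq = (g = 0)"
| "link (Asg g a) Ind = (g = 0)"
| "link (Asg g a) (Lit c r) = ((g = 0) \<noteq> mismatch g a c r)"
| "link Clq (Asg g a) = (g = 0)"
| "link Ind (Asg g a) = (g = 0)"
| "link (Lit c r) (Asg g a) = ((g = 0) \<noteq> mismatch g a c r)"
| "link Clq Clq = True"
| "link Clq (Lit c r) = True"
| "link (Lit c r) Clq = True"
| "link (Lit c r) (Lit c' r') = True"
| "link _ _ = False"

definition adj :: "nat \<Rightarrow> nat \<Rightarrow> bool" where
  "adj u v \<longleftrightarrow> u \<noteq> v \<and> link (kind u) (kind v)"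

abbreviation "G \<equiv> simple_graph N adj"

lemma link_sym: "link x y = link y x"
  by (cases x; cases y) auto

lemma adj_sym: "adj u v = adj v u"
  unfolding adj_def using link_sym by metis

lemma graph_G: "graph G" and graph_induce_G: "finite X \<Longrightarrow> graph (G \<restriction> X)"
proof -
  have "symp adj"
    by (rule sympI) (use adj_sym in blast)
  moreover have "irreflp adj"
    by (rule irreflpI) (simp add: adj_def)
  ultimately show "graph G" "finite X \<Longrightarrow> graph (G \<restriction> X)" by (rule graph_simple_graph)+
qed

section \<open>Numbering of the vertices by kind\<close>

lemma A_pos: "A > 0" by (simp add: A_def)

lemma kind_Asg:
  assumes "kind u = Asg g a"
  shows "g < L" and "a < A" and "u = g * A + a"
proof -
  have u: "u < L * A" "g = u div A" "a = u mod A"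
    using assms by (auto simp: kind_def Let_def split: if_splits)
  show "g < L" using u(1) by (simp add: u(2) less_mult_imp_div_less)
  show "a < A" using A_pos by (simp add: u(3))
  show "u = g * A + a" unfolding u(2,3) by (rule div_mult_mod_eq[symmetric])
qed

lemma kind_AsgI: "g < L \<Longrightarrow> a < A \<Longrightarrow> kind (g * A + a) = Asg g a"
proof -
  assume "g < L" "a < A"
  then have "g * A + a < L * A"
    using mult_le_mono1[of "Suc g" L A] by simp
  then show ?thesis using \<open>a < A\<close> by (simp add: kind_def)
qed

lemma kind_Clq: "kind u = Clq \<longleftrightarrow> u \<in> {L * A..<(L + 2) * A}"
  by (auto simp: kind_def Let_def)

lemma kind_Ind: "kind u = Ind \<longleftrightarrow> u \<ge> E"
  by (auto simp: kind_def Let_def E_def)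

lemma kind_Lit:
  "kind u = Lit c r \<longleftrightarrow> c < m \<and> r < q \<and> r < length (F ! c) \<and> u = (L + 2) * A + (c * q + r)"
proof
  assume "kind u = Lit c r"
  then have u: "u \<ge> (L + 2) * A" "u < E" "c = (u - (L + 2) * A) div q" "r = (u - (L + 2) * A) mod q"
    "r < length (F ! c)"
    by (auto simp: kind_def Let_def split: if_splits)
  then have "u - (L + 2) * A < m * q" by (simp add: E_def mult.commute less_diff_conv2)
  then have "c < m" using u(3) by (simp add: less_mult_imp_div_less)
  moreover have "c * q + r = u - (L + 2) * A" using u by simp
  ultimately show "c < m \<and> r < q \<and> r < length (F ! c) \<and> u = (L + 2) * A + (c * q + r)"
    using u q by simp
next
  assume a: "c < m \<and> r < q \<and> r < length (F ! c) \<and> u = (L + 2) * A + (c * q + r)"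
  then have "c * q + r < q * m"
    using mult_le_mono1[of "Suc c" m q] by (simp add: mult.commute)
  then show "kind u = Lit c r" using a by (simp add: kind_def E_def Let_def)
qed

lemma length_clause: "c < m \<Longrightarrow> length (F ! c) \<le> q"
  using cnf unfolding is_cnf_def m_def by (meson nth_mem)

lemma var_less: "c < m \<Longrightarrow> r < length (F ! c) \<Longrightarrow> fst (F ! c ! r) < n"
  using cnf unfolding is_cnf_def m_def by (metis (no_types, lifting) case_prod_unfold nth_mem)

lemma satisfiable_iff:
  "satisfiable F \<longleftrightarrow> (\<exists>\<sigma> :: nat \<Rightarrow> bool. \<forall>c<m. \<exists>r<length (F ! c). \<sigma> (fst (F ! c ! r)) = snd (F ! c ! r))"
proof -
  have "Bex (set C) P \<longleftrightarrow> (\<exists>r<length C. P (C ! r))" for C :: "literal list" and P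
    by (metis in_set_conv_nth)
  then show ?thesis
    by (simp add: satisfiable_def m_def all_set_conv_all_nth case_prod_unfold)
qed

section \<open>From a scorpion to a satisfying assignment\<close>

text \<open>Independent legs pin \<open>b\<close> to group 0, clique legs pin the rest of the path
  to the groups in order. Legs of other kinds are too few, so at least \<open>m\<close> clause
  vertices occur, at most one per clause, and each certifies its clause.\<close>

lemma satisfiable_if_scorpion:
  assumes "X \<subseteq> {..<N}" and "card X = K" and "scorpion l (G \<restriction> X)"
  shows "satisfiable F"
proof -
  from assms(3) have "\<exists>b ts s. let p = b # ts @ [s] in
        length ts = l \<and> distinct p \<and> set p \<subseteq> X \<and>
        (\<forall>i j. i < j \<and> j < length p \<longrightarrow> (p ! i \<rightarrow>\<^bsub>G \<restriction> X\<^esub> p ! j) = (j = Suc i)) \<and>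
        (\<forall>x \<in> X - set p. b \<rightarrow>\<^bsub>G \<restriction> X\<^esub> x) \<and>
        (\<forall>x \<in> X - set p. \<forall>y \<in> set p - {b}. \<not> (y \<rightarrow>\<^bsub>G \<restriction> X\<^esub> x))"
    unfolding scorpion_def induce_subgraph_verts by (elim conjE)
  then obtain b ts s where *: "let p = b # ts @ [s] in
        length ts = l \<and> distinct p \<and> set p \<subseteq> X \<and>
        (\<forall>i j. i < j \<and> j < length p \<longrightarrow> (p ! i \<rightarrow>\<^bsub>G \<restriction> X\<^esub> p ! j) = (j = Suc i)) \<and>
        (\<forall>x \<in> X - set p. b \<rightarrow>\<^bsub>G \<restriction> X\<^esub> x) \<and>
        (\<forall>x \<in> X - set p. \<forall>y \<in> set p - {b}. \<not> (y \<rightarrow>\<^bsub>G \<restriction> X\<^esub> x))"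
    by (elim exE)
  define p where "p = b # ts @ [s]"
  define Y where "Y = X - set p"
  note c = *[unfolded Let_def, folded p_def Y_def]
  note ts = c[THEN conjunct1] and dist = c[THEN conjunct2, THEN conjunct1]
    and pX = c[THEN conjunct2, THEN conjunct2, THEN conjunct1]
  note c = c[THEN conjunct2, THEN conjunct2, THEN conjunct2]
  note path = c[THEN conjunct1] and b = c[THEN conjunct2, THEN conjunct1]
    and t = c[THEN conjunct2, THEN conjunct2]
  have len: "length p = L" using ts by (simp add: p_def L_def)
  have b0: "p ! 0 = b" by (simp add: p_def)
  have pi: "p ! i \<in> X" if "i < L" for i using that len by (intro subsetD[OF pX] nth_mem) simp
  have path: "adj (p ! i) (p ! j) \<longleftrightarrow> j = Suc i" if "i < j" "j < L" for i j
    using path[rule_format, of i j] that pi[of i] pi[of j] assms(1) len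
    by (auto simp: simple_graph_induce_adj)
  have b: "adj b y" if "y \<in> Y" for y
    using b that by (auto simp: simple_graph_induce_adj)
  have t: "\<not> adj (p ! i) y" if "y \<in> Y" "1 \<le> i" "i < L" for i y
  proof -
    have "p ! i \<noteq> p ! 0"
      using that dist len by (simp add: nth_eq_iff_index_eq)
    then have "p ! i \<in> set p - {b}" using that len b0 by simp
    moreover have "p ! i < N" "y < N" using that assms(1) pi by (auto simp: Y_def)
    ultimately show ?thesis
      using t that pi by (auto simp: Y_def simple_graph_induce_adj)
  qed
  have fX: "finite X" using assms(1) finite_subset by blast
  have fY: "finite Y" using fX by (simp add: Y_def)
  have "card Y = K - L"
    unfolding Y_def using dist pX len assms(2) fX by (simp add: card_Diff_subset distinct_card)
  then have cY: "card Y = (E + 1) + 2 * A + m" by (simp add: K_def)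
  have YN: "Y \<subseteq> {..<N}" using assms(1) by (auto simp: Y_def)
  have cover: "card Y \<le> card S" if "Y \<subseteq> S" "finite S" for S
    using that by (simp add: card_mono)
  have L3: "L \<ge> 3" using l by (simp add: L_def)
  have np: "p ! i \<noteq> y" if "y \<in> Y" "i < L" for i y
    using that len by (auto simp: Y_def)

  \<comment> \<open>The legs outnumber all vertices outside the independent set.\<close>
  obtain d where d: "d \<in> Y" "kind d = Ind"
  proof -
    have "\<not> Y \<subseteq> {..<E}" using cover[of "{..<E}"] cY by auto
    then show ?thesis using that kind_Ind by (meson lessThan_iff not_le subsetI)
  qed
  \<comment> \<open>Independent vertices have neighbours in group 0 only.\<close>
  obtain a0 where a0: "kind b = Asg 0 a0"
    using b[OF d(1)] d(2) by (cases "kind b") (auto simp: adj_def)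
  \<comment> \<open>All of group 0 is adjacent to the leg \<open>d\<close>.\<close>
  have notB: "kind (p ! i) \<noteq> Asg 0 a" if "1 \<le> i" "i < L" for i a
    using t[OF d(1) that] d np[OF d(1) that(2)] by (auto simp: adj_def)
  \<comment> \<open>A neighbour on the path other than \<open>b\<close>; the last vertex needs its
    predecessor. Since it lies outside group 0, independent and isolated vertices are ruled
    out.\<close>
  have nbr: "\<exists>j. 1 \<le> j \<and> j < L \<and> adj (p ! i) (p ! j)" if "1 \<le> i" "i < L" for i
  proof (cases "Suc i < L")
    case True
    then show ?thesis using path[of i "Suc i"] by auto
  next
    case False
    then have "1 \<le> i - 1" "Suc (i - 1) = i" using that L3 by auto
    then show ?thesis using path[of "i - 1" i] that adj_sym
      by (intro exI[of _ "i - 1"]) auto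
  qed
  have notInd: "kind (p ! i) \<noteq> Ind" "kind (p ! i) \<noteq> Iso" if i: "1 \<le> i" "i < L" for i
  proof -
    obtain j where j: "1 \<le> j" "j < L" "adj (p ! i) (p ! j)" using nbr i by blast
    show "kind (p ! i) \<noteq> Ind" "kind (p ! i) \<noteq> Iso"
      using j(3) notB[OF j(1,2)] by (cases "kind (p ! j)"; auto simp: adj_def)+
  qed
  have adj1: "adj b (p ! 1)" using path[of 0 1] L3 b0 by simp
  have L1: "1 < L" using L3 by simp
  \<comment> \<open>If \<open>t\<^sub>1\<close> were in the clique, the clique would contain no legs, leaving too few of them.\<close>
  obtain a1 where a1: "kind (p ! 1) = Asg 1 a1"
  proof (cases "kind (p ! 1) = Clq \<or> (\<exists>c r. kind (p ! 1) = Lit c r)")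
    case True
    \<comment> \<open>Group 1 consists of the vertices \<open>{A..<2 * A}\<close>. Demanding
      \<open>2 * A\<close> clique legs exceeds its size even when there are no clauses.\<close>
    have "Y \<subseteq> {A..<2 * A} \<union> {E..<N}"
    proof
      fix y assume y: "y \<in> Y"
      then show "y \<in> {A..<2 * A} \<union> {E..<N}"
        using b[OF y] a0 t[OF y _ L1] True np[OF y L1] YN y kind_Asg(2,3)[of y 1]
        by (cases "kind y") (auto simp: adj_def kind_Ind)
    qed
    from cover[OF this] have "card Y \<le> A + (E + 1)"
      using card_Un_le[of "{A..<2 * A}" "{E..<N}"] by (simp add: N_def)
    with cY A_pos show ?thesis by simp
  next
    case False
    then show ?thesis
      using adj1 a0 notInd[OF _ L1] notB[OF _ L1] that by (cases "kind (p ! 1)") (auto simp: adj_def)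
  qed
  \<comment> \<open>Group 1 is a clique containing \<open>p ! 1\<close>, so none of its vertices is
    a leg.\<close>
  have kY: "kind y = Clq \<or> (\<exists>c r. kind y = Lit c r) \<or> kind y = Ind" if y: "y \<in> Y" for y
    using b[OF y] a0 t[OF y _ L1] a1 np[OF y L1]
    by (cases "kind y") (auto simp: adj_def)
  \<comment> \<open>Only \<open>E + 1\<close> vertices are independent, so some leg lies in the
    clique. It keeps all later path vertices out of the clique.\<close>
  obtain z where z: "z \<in> Y" "kind z = Clq \<or> (\<exists>c r. kind z = Lit c r)"
  proof -
    have "\<not> Y \<subseteq> {E..<N}" using cover[of "{E..<N}"] cY A_pos by (auto simp: N_def)
    then obtain z where "z \<in> Y" "z \<notin> {E..<N}" by blast
    then show ?thesis using that[of z] kY[of z] YN kind_Ind[of z] by auto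
  qed
  have asg: "\<exists>g a. kind (p ! i) = Asg g a \<and> g \<ge> 1" if i: "1 \<le> i" "i < L" for i
    using t[OF z(1) i] z(2) np[OF z(1) i(2)] notInd[OF i] notB[OF i]
    by (cases "kind (p ! i)") (auto simp: adj_def Suc_le_eq)
  have "\<forall>j\<le>i. \<exists>a. kind (p ! j) = Asg j a" if "i < L" for i
    using that
  proof (induction i)
    case 0
    then show ?case using a0 b0 by auto
  next
    case (Suc i)
    have "\<exists>a. kind (p ! Suc i) = Asg (Suc i) a"
    proof (cases i)
      case 0
      then show ?thesis using a1 by simp
    next
      case (Suc i')
      obtain g a where ga: "kind (p ! Suc i) = Asg g a" "g \<ge> 1" using asg[of "Suc i"] Suc.prems by auto
      obtain a' a'' where a': "kind (p ! i) = Asg i a'" "kind (p ! i') = Asg i' a''"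
        using Suc.IH Suc.prems Suc by fastforce
      \<comment> \<open>A neighbour of \<open>p ! i\<close> among the assignments lies in group
        \<open>i - 1\<close>, \<open>i\<close> or \<open>i + 1\<close>. The first two are adjacent
        to \<open>p ! i'\<close>, except that group 0 is no clique; \<open>g \<ge> 1\<close> settles
        that case.\<close>
      have "adj (p ! i) (p ! Suc i)" "\<not> adj (p ! i') (p ! Suc i)"
        using path[of i "Suc i"] path[of i' "Suc i"] Suc Suc.prems by auto
      moreover have "p ! i' \<noteq> p ! Suc i"
        using dist len Suc Suc.prems by (simp add: nth_eq_iff_index_eq)
      ultimately show ?thesis using ga a' Suc by (auto simp: adj_def)
    qed
    then show ?case using Suc by (auto simp: le_Suc_eq)
  qed
  then have "\<forall>g. \<exists>a. g < L \<longrightarrow> kind (p ! g) = Asg g a" by blast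
  then obtain as where as: "\<And>g. g < L \<Longrightarrow> kind (p ! g) = Asg g (as g)" by metis
  define \<sigma> where "\<sigma> v = odd (as (v mod L) div 2 ^ (v div L))" for v
  have first: "(\<sigma> (fst (F ! c ! r')) = snd (F ! c ! r')) = (r' = r)"
    if y: "y \<in> Y" "kind y = Lit c r" "r' \<le> r" for y c r r'
  proof -
    let ?g = "fst (F ! c ! r') mod L"
    have g: "?g < L" using L3 by simp
    \<comment> \<open>For \<open>b\<close> adjacency is required and means no mismatch, for the
      others it is forbidden and means a mismatch. Both cases exclude a mismatch.\<close>
    have "adj (p ! ?g) y = (?g = 0)"
      using b[OF y(1)] t[OF y(1) _ g] b0 by (cases "?g = 0") (auto simp: Suc_le_eq)
    then have "\<not> mismatch ?g (as ?g) c r"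
      using as[OF g] y(2) np[OF y(1) g] by (auto simp: adj_def)
    then show ?thesis using y(3) unfolding mismatch_def lit_true_def \<sigma>_def by blast
  qed
  define LY where "LY = {y \<in> Y. \<exists>c r. kind y = Lit c r}"
  \<comment> \<open>Legs that are not clause vertices have only \<open>2 * A + (E + 1)\<close>
    places, which leaves at least \<open>m\<close> clause vertices.\<close>
  have "Y \<subseteq> LY \<union> ({L * A..<(L + 2) * A} \<union> {E..<N})"
  proof
    fix y assume "y \<in> Y"
    then show "y \<in> LY \<union> ({L * A..<(L + 2) * A} \<union> {E..<N})"
      using kY[of y] YN kind_Clq[of y] kind_Ind[of y] unfolding LY_def by auto
  qed
  from cover[OF this] have "card Y \<le> card LY + (2 * A + (E + 1))"
    using card_Un_le[of LY "{L * A..<(L + 2) * A} \<union> {E..<N}"]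
      card_Un_le[of "{L * A..<(L + 2) * A}" "{E..<N}"] fY
    by (simp add: N_def LY_def algebra_simps)
  then have cLY: "card LY \<ge> m" using cY by simp
  define cl where "cl y = (case kind y of Lit c r \<Rightarrow> c | _ \<Rightarrow> 0)" for y
  \<comment> \<open>Two legs of one clause would each claim its first true literal.\<close>
  have "inj_on cl LY"
  proof (rule inj_onI)
    fix y y' assume "y \<in> LY" "y' \<in> LY" "cl y = cl y'"
    then obtain c r r' where k: "kind y = Lit c r" "kind y' = Lit c r'" "y \<in> Y" "y' \<in> Y"
      unfolding LY_def cl_def by auto
    have "r = r'"
      using first[OF k(3,1), of r'] first[OF k(4,2), of r] first[OF k(3,1), of r] first[OF k(4,2), of r']
      by (metis nle_le)
    then show "y = y'" using k kind_Lit by metis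
  qed
  moreover have img: "cl ` LY \<subseteq> {..<m}"
    unfolding LY_def cl_def using kind_Lit by fastforce
  ultimately have "cl ` LY = {..<m}"
    using cLY by (intro card_seteq) (auto simp: card_image)
  then have "\<exists>r<length (F ! c). \<sigma> (fst (F ! c ! r)) = snd (F ! c ! r)" if "c < m" for c
  proof -
    from that \<open>cl ` LY = {..<m}\<close> obtain y where "y \<in> LY" "cl y = c" by (metis imageE lessThan_iff)
    then obtain r where "y \<in> Y" "kind y = Lit c r" unfolding LY_def cl_def by auto
    then show ?thesis using first[of y c r r] kind_Lit by blast
  qed
  then show ?thesis unfolding satisfiable_iff by blast
qed

section \<open>From a satisfying assignment to a scorpion\<close>

lemma scorpion_if_satisfiable:
  assumes "satisfiable F"
  shows "\<exists>X\<subseteq>{..<N}. card X = K \<and> scorpion l (G \<restriction> X)"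
proof -
  obtain \<sigma> :: "nat \<Rightarrow> bool" where \<sigma>: "\<And>c. c < m \<Longrightarrow> \<exists>r<length (F ! c). \<sigma> (fst (F ! c ! r)) = snd (F ! c ! r)"
    using assms unfolding satisfiable_iff by blast
  \<comment> \<open>Digit \<open>y\<close> of group \<open>g\<close> is variable
    \<open>y * L + g\<close>, inverting the split into \<open>v mod L\<close> and
    \<open>v div L\<close>.\<close>
  have "\<forall>g. \<exists>a::nat. a < A \<and> (\<forall>y < h. odd (a div 2 ^ y) = \<sigma> (y * L + g))"
    unfolding A_def by (intro allI ex_digits)
  then obtain as :: "nat \<Rightarrow> nat" where as: "\<And>g. as g < A" "\<And>g y. y < h \<Longrightarrow> odd (as g div 2 ^ y) = \<sigma> (y * L + g)"
    by metis
  define P where "P g = g * A + as g" for g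
  have P: "kind (P g) = Asg g (as g)" if "g < L" for g
    unfolding P_def using kind_AsgI[OF that as(1)] .
  have lit: "lit_true (as (fst lt mod L)) lt \<longleftrightarrow> \<sigma> (fst lt) = snd lt" if "fst lt < n" for lt
  proof -
    have "fst lt div L < h" using that by (simp add: h_def div_le_mono le_imp_less_Suc)
    then show ?thesis by (simp add: lit_true_def as(2))
  qed
  \<comment> \<open>The position of the first true literal; by minimality no group has a mismatch
    there.\<close>
  define R where "R c = (LEAST r. r < length (F ! c) \<and> \<sigma> (fst (F ! c ! r)) = snd (F ! c ! r))" for c
  have R: "R c < length (F ! c)" "\<sigma> (fst (F ! c ! R c)) = snd (F ! c ! R c)" if "c < m" for c
    using LeastI_ex[OF \<sigma>[OF that]] unfolding R_def by blast+
  have R_least: "\<sigma> (fst (F ! c ! r)) \<noteq> snd (F ! c ! r)" if "r < R c" "c < m" for c r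
    using not_less_Least[of r] that R(1)[OF that(2)] unfolding R_def by fastforce
  have mm: "\<not> mismatch g (as g) c (R c)" if c: "c < m" for g c
  proof
    assume "mismatch g (as g) c (R c)"
    then obtain r where r: "r \<le> R c" "fst (F ! c ! r) mod L = g"
      "lit_true (as g) (F ! c ! r) \<noteq> (r = R c)" unfolding mismatch_def by blast
    have "r < length (F ! c)" using r(1) R(1)[OF c] by simp
    from lit[OF var_less[OF c this]] have "lit_true (as g) (F ! c ! r) \<longleftrightarrow> \<sigma> (fst (F ! c ! r)) = snd (F ! c ! r)"
      using r(2) by simp
    with r R(2)[OF c] R_least[OF _ c, of r] show False by (cases "r = R c") auto
  qed
  define Q where "Q c = (L + 2) * A + (c * q + R c)" for c
  have Q: "kind (Q c) = Lit c (R c)" if "c < m" for c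
    using that R(1)[OF that] length_clause[OF that] by (simp add: kind_Lit Q_def)

  define C where "C = {L * A..<(L + 2) * A} \<union> {E..<N}"
  have C: "kind x = Clq \<or> kind x = Ind" if "x \<in> C" for x
    using that unfolding C_def by (auto simp: kind_Clq kind_Ind)
  define X where "X = P ` {..<L} \<union> (C \<union> Q ` {..<m})"
  have small: "kind x \<noteq> Ind \<Longrightarrow> x < N" for x
    by (auto simp: kind_Ind N_def)
  have XN: "X \<subseteq> {..<N}"
    unfolding X_def C_def using small P Q by (fastforce simp: N_def E_def)
  have injP: "inj_on P {..<L}"
    by (rule inj_onI) (metis P kind.inject(1) lessThan_iff)
  have injQ: "inj_on Q {..<m}"
    by (rule inj_onI) (metis Q kind.inject(2) lessThan_iff)
  have "card C = 2 * A + (E + 1)"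
    unfolding C_def by (subst card_Un_disjoint) (auto simp: N_def E_def algebra_simps)
  moreover have "C \<inter> Q ` {..<m} = {}" "P ` {..<L} \<inter> (C \<union> Q ` {..<m}) = {}"
    using P Q C by fastforce+
  ultimately have cardX: "card X = K"
    unfolding X_def using injP injQ
    by (simp add: card_Un_disjoint card_image K_def C_def)
  have finX: "finite X" using XN finite_subset by blast

  define p where "p = map P [0..<L]"
  define ts where "ts = map P [1..<Suc l]"
  have p: "P 0 # ts @ [P (Suc l)] = p"
    unfolding p_def ts_def L_def by (simp add: upt_rec[of 0] del: upt_Suc) (simp)
  have setp: "set p = P ` {..<L}" by (auto simp: p_def)
  have pi: "p ! i = P i" if "i < L" for i using that by (simp add: p_def)
  have L0: "0 < L" by (simp add: L_def)
  have XQ: "X - set p \<subseteq> C \<union> Q ` {..<m}" unfolding X_def setp by blast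
  have 1: "adj (P g) y = (g = 0)" if g: "g < L" and y: "y \<in> C \<union> Q ` {..<m}" for g y
  proof -
    have "kind y = Clq \<or> kind y = Ind \<or> (\<exists>c<m. kind y = Lit c (R c))"
      using y C Q by blast
    then show ?thesis using P[OF g] mm unfolding adj_def by fastforce
  qed
  have inX: "P g \<in> X" if "g < L" for g using that by (simp add: X_def)
  have 2: "adj (P i) (P j) \<longleftrightarrow> j = Suc i" if "i < j" "j < L" for i j
    using P[of i] P[of j] that by (auto simp: adj_def)
  have "scorpion l (G \<restriction> X)"
    unfolding scorpion_def induce_subgraph_verts
  proof (intro conjI)
    show "graph (G \<restriction> X)" by (rule graph_induce_G[OF finX])
    show "l + 4 \<le> card X" using A_pos unfolding cardX K_def L_def by simp
    have f1: "distinct p" "set p \<subseteq> X" "length ts = l" and len: "length p = L"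
      using injP inX unfolding setp by (auto simp: p_def ts_def distinct_map atLeast0LessThan)
    have f2: "(p ! i \<rightarrow>\<^bsub>G \<restriction> X\<^esub> p ! j) = (j = Suc i)" if "i < j" "j < L" for i j
      using 2[OF that] that inX[of i] inX[of j] XN pi
      by (auto simp: simple_graph_induce_adj)
    have f3: "P 0 \<rightarrow>\<^bsub>G \<restriction> X\<^esub> x" if "x \<in> X - set p" for x
      using 1[of 0 x] L0 that XQ XN inX[OF L0] by (auto simp: simple_graph_induce_adj)
    have f4: "\<not> y \<rightarrow>\<^bsub>G \<restriction> X\<^esub> x" if x: "x \<in> X - set p" and y: "y \<in> set p - {P 0}" for x y
    proof -
      obtain g where "g < L" "y = P g" "g \<noteq> 0" using y unfolding setp by auto
      then show ?thesis using 1[of g x] x XQ by (auto simp: simple_graph_induce_adj)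
    qed
    show "\<exists>b ts s. let p = b # ts @ [s] in
        length ts = l \<and> distinct p \<and> set p \<subseteq> X \<and>
        (\<forall>i j. i < j \<and> j < length p \<longrightarrow> (p ! i \<rightarrow>\<^bsub>G \<restriction> X\<^esub> p ! j) = (j = Suc i)) \<and>
        (\<forall>x \<in> X - set p. b \<rightarrow>\<^bsub>G \<restriction> X\<^esub> x) \<and>
        (\<forall>x \<in> X - set p. \<forall>y \<in> set p - {b}. \<not> (y \<rightarrow>\<^bsub>G \<restriction> X\<^esub> x))"
      by (rule exI[of _ "P 0"], rule exI[of _ ts], rule exI[of _ "P (Suc l)"], unfold p Let_def len)
        (intro conjI allI impI ballI f1 f2 f3 f4; (elim conjE)?; assumption)
  qed
  with XN cardX show ?thesis by blast
qed

lemma scorpion_count_pos_iff: "scorpion_count l G K > 0 \<longleftrightarrow> satisfiable F"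
proof -
  have "finite {X. X \<subseteq> verts G \<and> card X = K \<and> scorpion l (G \<restriction> X)}"
    by (rule finite_subset[of _ "Pow {..<N}"]) auto
  then have "scorpion_count l G K > 0 \<longleftrightarrow> (\<exists>X\<subseteq>{..<N}. card X = K \<and> scorpion l (G \<restriction> X))"
    unfolding scorpion_count_def by (auto simp: card_gt_0_iff)
  then show ?thesis using satisfiable_if_scorpion scorpion_if_satisfiable by blast
qed

text \<open>The answer has at most \<open>N + 1\<close> bits, which bounds the cost of inspecting
  it.\<close>

lemma scorpion_count_le: "scorpion_count l G k \<le> 2 ^ N"
proof -
  have "scorpion_count l G k \<le> card (Pow {..<N})"
    unfolding scorpion_count_def by (rule card_mono) auto
  then show ?thesis by (simp add: card_Pow)
qed

end

section \<open>Constructing the graph\<close>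

lemma length_concat_same: "(\<And>x. x \<in> set xs \<Longrightarrow> length (g x) = n) \<Longrightarrow> length (concat (map g xs)) = length xs * n"
  by (induction xs) auto

lemma nth_concat_rows:
  assumes "x < k * n"
  shows "concat (map (\<lambda>u. map (f u) [0..<n]) [0..<k]) ! x = f (x div n) (x mod n)"
  using assms
proof (induction k)
  case (Suc k)
  have n: "n > 0" using Suc.prems by (cases n) auto
  have len: "length (concat (map (\<lambda>u. map (f u) [0..<n]) [0..<k])) = k * n"
    by (subst length_concat_same[where n = n]) auto
  show ?case
  proof (cases "x < k * n")
    case True
    then show ?thesis using Suc.IH len by (simp add: nth_append)
  next
    case False
    then obtain y where y: "x = k * n + y" by (metis le_Suc_ex not_less)
    with Suc.prems have "y < n" by simp
    with n have "x div n = k" "x mod n = y" by (simp_all add: y)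
    then show ?thesis using len \<open>y < n\<close> y by (simp add: nth_append)
  qed
qed simp

lemma nth_binary_digits:
  "(if i < length (binary_digits k) then Suc (binary_digits k ! i) else 0)
    = (if k div 2 ^ i = 0 then 0 else Suc (k div 2 ^ i mod 2))"
proof (induction k arbitrary: i rule: binary_digits.induct)
  case (1 k)
  show ?case
  proof (cases "k = 0")
    case False
    show ?thesis
    proof (cases i)
      case (Suc j)
      show ?thesis
        using 1[OF False, of j] False Suc
        by (subst (1 2) binary_digits.simps) (simp add: div_mult2_eq split: if_splits)
    qed (use False in \<open>subst (1 2) binary_digits.simps, simp\<close>)
  qed (simp add: binary_digits.simps)
qed

lemma length_encode_graph: "length (encode_graph n H) = Suc (n * n)"
  unfolding encode_graph_def by (simp add: length_concat_same[where n = n])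

definition instance_cell :: "nat \<Rightarrow> (nat \<Rightarrow> nat \<Rightarrow> bool) \<Rightarrow> nat \<Rightarrow> nat \<Rightarrow> nat" where
  "instance_cell N R k x = (case x of 0 \<Rightarrow> N | Suc i \<Rightarrow>
     if i < N * N then of_bool (R (i div N) (i mod N))
     else (let d = k div 2 ^ (i - N * N) in if d = 0 then 0 else Suc (d mod 2)))"

text \<open>Since \<open>k < 2 ^ k\<close>, the first \<open>k\<close> digit cells contain all
  digits, and every cell past \<open>N * N + k\<close> is 0. This crude length is affordable as
  \<open>K\<close> is at most \<open>N\<close>.\<close>

lemma input_mem_encode_graph:
  "input_mem (encode_graph N (simple_graph N R) @ map Suc (binary_digits k))
    = filled (instance_cell N R k) (N * N + k)"
proof
  fix x
  let ?xs = "encode_graph N (simple_graph N R) @ map Suc (binary_digits k)"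
  show "input_mem ?xs x = filled (instance_cell N R k) (N * N + k) x"
  proof (cases x)
    case 0
    then show ?thesis
      by (simp add: input_mem_def filled_def instance_cell_def encode_graph_def)
  next
    case (Suc i)
    show ?thesis
    proof (cases "i < N * N")
      case True
      then have "N > 0" by (cases N) auto
      then have "i div N < N" "i mod N < N"
        using True by (simp_all add: less_mult_imp_div_less)
      moreover have "x < length (encode_graph N (simple_graph N R))"
        using Suc True by (simp add: length_encode_graph)
      ultimately show ?thesis using Suc True
        by (simp add: input_mem_def filled_def instance_cell_def nth_append encode_graph_def
          nth_concat_rows trans_less_add1)
    next
      case False
      then obtain j where j: "i = N * N + j" by (metis le_Suc_ex not_less)
      have "input_mem ?xs x = (if j < length (binary_digits k) then Suc (binary_digits k ! j) else 0)"
        by (simp add: Suc j input_mem_def nth_append length_encode_graph)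
      also have "\<dots> = (if k div 2 ^ j = 0 then 0 else Suc (k div 2 ^ j mod 2))"
        by (rule nth_binary_digits)
      also have "\<dots> = filled (instance_cell N R k) (N * N + k) x"
      proof (cases "Suc j \<le> k")
        case False
        then have "k < 2 ^ j" by (metis less_exp le_less_trans not_less_eq_eq)
        then show ?thesis using False by (simp add: Suc j filled_def)
      qed (simp add: Suc j filled_def instance_cell_def Let_def)
      finally show ?thesis .
    qed
  qed
qed

section \<open>Boolean operations by truncated subtraction\<close>

definition NotE :: "expr \<Rightarrow> expr" where "NotE e = Minus (Num 1) e"
definition LeE :: "expr \<Rightarrow> expr \<Rightarrow> expr" where "LeE e f = NotE (Minus e f)"
definition LtE :: "expr \<Rightarrow> expr \<Rightarrow> expr" where "LtE e f = NotE (LeE f e)"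
definition EqE :: "expr \<Rightarrow> expr \<Rightarrow> expr" where "EqE e f = NotE (Plus (Minus e f) (Minus f e))"
definition AndE :: "expr \<Rightarrow> expr \<Rightarrow> expr" where "AndE e f = NotE (NotE (Times e f))"
definition OrE :: "expr \<Rightarrow> expr \<Rightarrow> expr" where "OrE e f = NotE (NotE (Plus e f))"
definition ModE :: "expr \<Rightarrow> expr \<Rightarrow> expr" where "ModE e f = Minus e (Times f (Div e f))"

text \<open>A bounded existential quantifier unrolled into the program text, possible because its
  range \<open>q\<close> is fixed.\<close>

primrec AnyE :: "nat \<Rightarrow> (nat \<Rightarrow> expr) \<Rightarrow> expr" where
  "AnyE 0 f = Num 0"
| "AnyE (Suc k) f = OrE (f k) (AnyE k f)"

lemma val_NotE [simp]: "val (NotE e) m = of_bool (val e m = 0)"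
  by (cases "val e m") (auto simp: NotE_def)

lemma val_bool_exprs [simp]:
  "val (LeE e f) m = of_bool (val e m \<le> val f m)"
  "val (LtE e f) m = of_bool (val e m < val f m)"
  "val (EqE e f) m = of_bool (val e m = val f m)"
  "val (AndE e f) m = of_bool (val e m \<noteq> 0 \<and> val f m \<noteq> 0)"
  "val (OrE e f) m = of_bool (val e m \<noteq> 0 \<or> val f m \<noteq> 0)"
  "val (ModE e f) m = val e m mod val f m"
  by (auto simp: LeE_def LtE_def EqE_def AndE_def OrE_def ModE_def minus_mult_div_eq_mod)

lemma val_AnyE: "val (AnyE k f) m = of_bool (\<exists>i<k. val (f i) m \<noteq> 0)"
  by (induction k) (auto simp: less_Suc_eq)

section \<open>Expressions for sizes and adjacency\<close>

context
  fixes L q :: nat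
begin

definition "hE = Plus (Div (Mem (Num 0)) (Num L)) (Num 1)"
text \<open>The machine has no exponentiation, so \<open>2 ^ h\<close> is looked up in the table of
  powers.\<close>

definition "AE = Cell q 1 hE"
definition "LAE = Times (Num L) AE"
definition "LA2E = Times (Num (L + 2)) AE"
definition "EE = Plus LA2E (Times (Num q) (Mem (Num 1)))"
definition "NE = Plus (Times (Num 2) EE) (Num 1)"
definition "KE = Plus (Plus (Plus (Num L) (Plus EE (Num 1))) (Times (Num 2) AE)) (Mem (Num 1))"

definition "isAsg u = LtE u LAE"
definition "isClq u = AndE (LeE LAE u) (LtE u LA2E)"
definition "clauseE u = Div (Minus u LA2E) (Num q)"
definition "posE u = ModE (Minus u LA2E) (Num q)"
definition "isLit u = AndE (AndE (LeE LA2E u) (LtE u EE)) (LtE (posE u) (Mem (Cell q 2 (clauseE u))))"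
definition "isInd u = LeE EE u"

text \<open>Array 2 holds the address of the length cell of clause \<open>c\<close>; the codes of
  its literals follow that cell.\<close>

definition "codeE c i = Mem (Plus (Cell q 2 c) (Num (Suc i)))"
definition "varE c i = Div (codeE c i) (Num 2)"
definition "litTrueE a c i =
  EqE (ModE (Div a (Cell q 1 (Div (varE c i) (Num L)))) (Num 2)) (ModE (codeE c i) (Num 2))"
definition "mismatchE g a c r = AnyE q (\<lambda>i. AndE (LeE (Num i) r)
  (AndE (EqE (ModE (varE c i) (Num L)) g) (NotE (EqE (litTrueE a c i) (EqE (Num i) r)))))"

definition "linkAsgE u v = AndE (isAsg u)
  (OrE (AndE (OrE (isClq v) (isInd v)) (EqE (Div u AE) (Num 0)))
    (AndE (isLit v) (NotE (EqE (EqE (Div u AE) (Num 0))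
      (mismatchE (Div u AE) (ModE u AE) (clauseE v) (posE v))))))"
definition "linkAsgsE u v = AndE (AndE (isAsg u) (isAsg v))
  (OrE (EqE (Div v AE) (Plus (Div u AE) (Num 1)))
    (OrE (EqE (Div u AE) (Plus (Div v AE) (Num 1)))
      (AndE (EqE (Div u AE) (Div v AE)) (Div u AE))))"
definition "linkCliqueE u v = AndE (OrE (isClq u) (isLit u)) (OrE (isClq v) (isLit v))"
definition "adjE u v = AndE (NotE (EqE u v))
  (OrE (OrE (linkAsgE u v) (linkAsgE v u)) (OrE (linkAsgsE u v) (linkCliqueE u v)))"

text \<open>The next entries of three tables: powers of two, addresses of clauses, and the iterated
  halves of \<open>K\<close>, whose parities are its digits.\<close>

definition "powStep = Times (Num 2) (Cell q 1 (cnt q))"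
definition "startStep = Plus (Plus (Cell q 2 (cnt q)) (Num 1)) (Mem (Cell q 2 (cnt q)))"
definition "quotStep = Div (Cell q 3 (cnt q)) (Num 2)"
definition "NNE = Times NE NE"
definition "instanceStep =
  Plus (Times (LtE (cnt q) NNE) (adjE (Div (cnt q) NE) (ModE (cnt q) NE)))
    (Times (LeE NNE (cnt q))
      (Times (LtE (Num 0) (Cell q 3 (Minus (cnt q) NNE)))
        (Plus (Num 1) (ModE (Cell q 3 (Minus (cnt q) NNE)) (Num 2)))))"
definition "instanceBound = Plus NNE KE"

definition "build_instance =
  Seq (Seq (fill q 1 (Num 1) hE powStep) (fill q 2 (Num 2) (Mem (Num 1)) startStep))
    (Seq (fill q 3 KE KE quotStep) (fill q 4 NE instanceBound instanceStep))"

definition "build_const =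
  (fill_const q 1 (Num 1) hE powStep + fill_const q 2 (Num 2) (Mem (Num 1)) startStep) +
  (fill_const q 3 KE KE quotStep + fill_const q 4 NE instanceBound instanceStep)"

definition "decide_sat P =
  Seq (Seq build_instance (trans_prog q P))
    (Store (Num 0) (trans_expr q (NotE (NotE (Mem (Num 0))))))"

end

section \<open>The formula in memory\<close>

context reduction
begin

definition "I = input_mem (encode_cnf n F)"

text \<open>The address of the length cell of clause \<open>c\<close>. The 2 skips the numbers of
  variables and clauses; \<open>start m\<close> is the length of the input.\<close>

primrec start :: "nat \<Rightarrow> nat" where
  "start 0 = 2"
| "start (Suc c) = start c + 1 + length (F ! c)"

definition "enc_clause C = length C # map (\<lambda>(v, p). 2 * v + of_bool p) C" for C :: "literal list"

lemma start_eq: "c \<le> m \<Longrightarrow> start c = 2 + length (concat (map enc_clause (take c F)))"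
  by (induction c) (auto simp: take_Suc_conv_app_nth m_def enc_clause_def)

lemma I_0 [simp]: "I 0 = n" and I_1 [simp]: "I (Suc 0) = m"
  by (simp_all add: I_def input_mem_def encode_cnf_def m_def)

lemma I_start:
  assumes "c < m" and "i < Suc (length (F ! c))"
  shows "I (start c + i) = enc_clause (F ! c) ! i"
proof -
  let ?p = "concat (map enc_clause (take c F))"
  have "concat (map enc_clause F) = ?p @ enc_clause (F ! c) @ concat (map enc_clause (drop (Suc c) F))"
    using assms(1) by (subst id_take_nth_drop[of c F]) (simp_all add: m_def)
  then have e: "encode_cnf n F = ([n, m] @ ?p) @ enc_clause (F ! c) @ concat (map enc_clause (drop (Suc c) F))"
    by (simp add: encode_cnf_def m_def enc_clause_def[abs_def])
  have s: "start c = length ([n, m] @ ?p)" using start_eq[of c] assms(1) by simp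
  have i: "i < length (enc_clause (F ! c))" using assms(2) by (simp add: enc_clause_def)
  show ?thesis
    unfolding I_def input_mem_def e s nth_append_length_plus using i by (simp add: nth_append)
qed

lemma I_start_length: "c < m \<Longrightarrow> I (start c) = length (F ! c)"
  using I_start[of c 0] by (simp add: enc_clause_def)

lemma I_start_code:
  assumes "c < m" and "i < length (F ! c)"
  shows "I (start c + Suc i) = 2 * fst (F ! c ! i) + of_bool (snd (F ! c ! i))"
  using I_start[of c "Suc i"] assms by (simp add: enc_clause_def case_prod_unfold)

lemma start_le: "c \<le> m \<Longrightarrow> start c \<le> 2 + (q + 1) * c"
proof (induction c)
  case (Suc c)
  then show ?case using length_clause[of c] by simp
qed simp

lemma origin_I: "origin q I = 2 + (q + 1) * m"
  by (simp add: origin_def)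

lemma start_origin: "c < m \<Longrightarrow> i \<le> length (F ! c) \<Longrightarrow> start c + i < origin q I"
  using start_le[of "Suc c"] mult_le_mono2[of "Suc c" m "q + 1"] by (simp add: origin_I)

text \<open>The input has length at most \<open>origin q I\<close>, so initially all arrays are
  zero.\<close>

lemma layout_input_list: "layout q I (\<lambda>_ _. 0) = input_mem (encode_cnf n F)"
proof
  fix x
  have "length (encode_cnf n F) = start m"
    using start_eq[of m] by (simp add: encode_cnf_def m_def enc_clause_def[abs_def])
  then have "length (encode_cnf n F) \<le> origin q I"
    using start_le[of m] by (simp add: origin_I)
  then show "layout q I (\<lambda>_ _. 0) x = input_mem (encode_cnf n F) x"
    by (simp add: layout_def Let_def I_def input_mem_def)
qed

lemma n_less: "n < L * A"
proof -
  have "n div L < A" unfolding A_def h_def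
    by (rule less_trans[OF _ less_exp]) simp
  moreover have "L > 0" by (simp add: L_def)
  ultimately show ?thesis by (metis div_less_iff_less_mult mult.commute)
qed

lemma A_ge_2: "A \<ge> 2"
  by (simp add: A_def h_def)

lemma E_ge: "L * A + 2 * A + m \<le> E" "L \<le> L * A" "m \<le> q * m"
  using A_ge_2 q by (simp_all add: E_def distrib_right mult_le_mono1[of 1 q m, simplified])

text \<open>The graph is so large that its number of vertices bounds the table entries; bit lengths
  are therefore logarithmic in \<open>N\<close>.\<close>

lemma bounds: "2 * n \<le> N" "m \<le> N" "K \<le> N" "h \<le> N" "A \<le> N"
proof -
  have "h < A" unfolding A_def by (rule less_exp)
  then show "2 * n \<le> N" "m \<le> N" "K \<le> N" "h \<le> N" "A \<le> N"
    using n_less E_ge A_ge_2 unfolding N_def K_def by linarith+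
qed

lemma start_le_N: "c \<le> m \<Longrightarrow> start c \<le> N"
proof -
  assume c: "c \<le> m"
  have "start c \<le> 2 + (q + 1) * m"
    using start_le[OF c] mult_le_mono2[OF c, of "q + 1"] by simp
  then have "start c \<le> 2 + m + q * m" by simp
  moreover have "E = L * A + 2 * A + q * m" by (simp add: E_def distrib_right)
  ultimately show ?thesis using A_ge_2 E_ge(3) unfolding N_def by linarith
qed

lemma I_le: "I x \<le> N"
proof (cases "x < length (encode_cnf n F)")
  case True
  then have "I x \<in> set (encode_cnf n F)" by (simp add: I_def input_mem_def)
  then consider "I x = n" | "I x = m" | C where "C \<in> set F" "I x = length C"
    | C v b where "C \<in> set F" "(v, b) \<in> set C" "I x = 2 * v + of_bool b"
    by (auto simp: encode_cnf_def m_def)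
  then show ?thesis
  proof cases
    case 3
    then have "m > 0" "length C \<le> q" using cnf by (auto simp: m_def is_cnf_def)
    then have "length C \<le> q * m" by (simp add: trans_le_add1 order_trans[OF _ mult_le_mono2[of 1 m q]])
    then show ?thesis using 3 by (simp add: N_def E_def)
  next
    case 4
    then have "v < n" using cnf by (auto simp: is_cnf_def)
    then show ?thesis using 4 bounds(1) by simp
  qed (use bounds in simp_all)
qed (simp add: I_def input_mem_def)

lemma kind_range_iff:
  "(\<exists>g a. kind u = Asg g a) \<longleftrightarrow> u < L * A"
  "kind u = Clq \<longleftrightarrow> L * A \<le> u \<and> u < (L + 2) * A"
  "(\<exists>c r. kind u = Lit c r) \<longleftrightarrow> (L + 2) * A \<le> u \<and> u < E \<and>
     (u - (L + 2) * A) mod q < length (F ! ((u - (L + 2) * A) div q))"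
  "kind u = Ind \<longleftrightarrow> E \<le> u"
  using E_ge by (auto simp: kind_def Let_def)

text \<open>The disjunction has the shape of \<open>adjE\<close>, whose value then follows by
  rewriting.\<close>

lemma link_iff:
  "link k k' \<longleftrightarrow>
    (\<exists>g a. k = Asg g a \<and> ((k' = Clq \<or> k' = Ind) \<and> g = 0 \<or>
      (\<exists>c r. k' = Lit c r \<and> ((g = 0) \<noteq> mismatch g a c r)))) \<or>
    (\<exists>g a. k' = Asg g a \<and> ((k = Clq \<or> k = Ind) \<and> g = 0 \<or>
      (\<exists>c r. k = Lit c r \<and> ((g = 0) \<noteq> mismatch g a c r)))) \<or>
    (\<exists>g a g' a'. k = Asg g a \<and> k' = Asg g' a' \<and> (g' = g + 1 \<or> g = g' + 1 \<or> g = g' \<and> g \<noteq> 0)) \<or>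
    (k = Clq \<or> (\<exists>c r. k = Lit c r)) \<and> (k' = Clq \<or> (\<exists>c r. k' = Lit c r))"
  by (cases k; cases k') auto

lemma kind_eq_Asg_iff: "kind u = Asg g a \<longleftrightarrow> u < L * A \<and> g = u div A \<and> a = u mod A"
  by (auto simp: kind_def Let_def)

lemma kind_eq_Lit_iff: "kind u = Lit c r \<longleftrightarrow> ((L + 2) * A \<le> u \<and> u < E \<and>
     (u - (L + 2) * A) mod q < length (F ! ((u - (L + 2) * A) div q))) \<and>
     c = (u - (L + 2) * A) div q \<and> r = (u - (L + 2) * A) mod q"
  by (auto simp: kind_def Let_def)

end

section \<open>Values of the expressions\<close>

text \<open>Only table entries are assumed, not a particular memory, because the expressions are
  evaluated in every intermediate memory of the loops.\<close>

locale reduction_powers = reduction +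
  fixes arr :: "nat \<Rightarrow> nat \<Rightarrow> nat"
  assumes arr1: "y \<le> h \<Longrightarrow> arr 1 y = 2 ^ y"
begin

abbreviation "S \<equiv> layout q I arr"

lemma val_sizes [simp]:
  "val (hE L) S = h" "val (AE L q) S = A" "val (LAE L q) S = L * A" "val (LA2E L q) S = (L + 2) * A"
  "val (EE L q) S = E" "val (NE L q) S = N" "val (KE L q) S = K"
  "val (NNE L q) S = N * N" "val (instanceBound L q) S = N * N + K"
proof -
  show h: "val (hE L) S = h" by (simp add: hE_def h_def)
  show A: "val (AE L q) S = A" by (simp add: AE_def h arr1[of h, simplified] A_def)
  show "val (LAE L q) S = L * A" by (simp add: LAE_def A)
  show A2: "val (LA2E L q) S = (L + 2) * A" by (simp add: LA2E_def A)
  show E: "val (EE L q) S = E" by (simp add: EE_def E_def A2)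
  show N: "val (NE L q) S = N" by (simp add: NE_def N_def E)
  show K: "val (KE L q) S = K" by (simp add: KE_def K_def A E)
  show NN: "val (NNE L q) S = N * N" by (simp add: NNE_def N)
  show "val (instanceBound L q) S = N * N + K" by (simp add: instanceBound_def NN K)
qed

end

locale reduction_tables = reduction_powers +
  assumes arr2: "c < m \<Longrightarrow> arr 2 c = start c"
begin

text \<open>Positions beyond \<open>r\<close> may read arbitrary cells, but the test
  \<open>i \<le> r\<close> cancels them. As \<open>r < q\<close>, the \<open>q\<close> unrolled
  cases reach every position needed.\<close>

lemma val_mismatchE:
  assumes c: "val ce S < m" and r: "val re S < length (F ! val ce S)"
  shows "val (mismatchE L q ge ae ce re) S = of_bool (mismatch (val ge S) (val ae S) (val ce S) (val re S))"
proof -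
  let ?c = "val ce S" and ?r = "val re S" and ?a = "val ae S" and ?g = "val ge S"
  have rq: "?r < q" using r length_clause[OF c] by simp
  have code: "val (codeE q ce i) S = 2 * fst (F ! ?c ! i) + of_bool (snd (F ! ?c ! i))" if "i \<le> ?r" for i
  proof -
    have i: "i < length (F ! ?c)" using that r by simp
    have "start ?c + Suc i < origin q I" using start_origin[OF c, of "Suc i"] i by simp
    then show ?thesis using I_start_code[OF c i] c by (simp add: codeE_def arr2)
  qed
  have var: "val (varE q ce i) S = fst (F ! ?c ! i)" if "i \<le> ?r" for i
    using code[OF that] by (simp add: varE_def)
  have lt: "val (litTrueE L q ae ce i) S = of_bool (lit_true ?a (F ! ?c ! i))" if i: "i \<le> ?r" for i
  proof -
    have "fst (F ! ?c ! i) < n" using var_less[OF c] i r by simp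
    then have "fst (F ! ?c ! i) div L \<le> h" by (simp add: h_def div_le_mono le_SucI)
    then show ?thesis
      using code[OF i] var[OF i]
      by (auto simp: litTrueE_def lit_true_def arr1[simplified] odd_iff_mod_2_eq_one)
  qed
  have "val (mismatchE L q ge ae ce re) S = of_bool (\<exists>i<q. i \<le> ?r \<and> fst (F ! ?c ! i) mod L = ?g \<and>
       lit_true ?a (F ! ?c ! i) \<noteq> (i = ?r))"
    unfolding mismatchE_def val_AnyE
    by (intro arg_cong[where f = of_bool] ex_cong1) (auto simp: var lt split: if_splits)
  also have "\<dots> = of_bool (mismatch ?g ?a ?c ?r)"
  proof -
    have "(\<exists>i<q. i \<le> ?r \<and> P i) \<longleftrightarrow> (\<exists>i\<le>?r. P i)" for P
      using rq le_less_trans by blast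
    then show ?thesis unfolding mismatch_def by simp
  qed
  finally show ?thesis .
qed

lemma div_less_m: "u < E \<Longrightarrow> (L + 2) * A \<le> u \<Longrightarrow> (u - (L + 2) * A) div q < m"
  by (rule less_mult_imp_div_less) (simp add: E_def mult.commute less_diff_conv2)

lemma val_kinds [simp]:
  "val (isAsg L q u) S = of_bool (\<exists>g a. kind (val u S) = Asg g a)"
  "val (isClq L q u) S = of_bool (kind (val u S) = Clq)"
  "val (isLit L q u) S = of_bool (\<exists>c r. kind (val u S) = Lit c r)"
  "val (isInd L q u) S = of_bool (kind (val u S) = Ind)"
proof -
  show "val (isAsg L q u) S = of_bool (\<exists>g a. kind (val u S) = Asg g a)"
    unfolding kind_range_iff by (simp add: isAsg_def)
  show "val (isClq L q u) S = of_bool (kind (val u S) = Clq)"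
    unfolding kind_range_iff by (simp add: isClq_def)
  show "val (isInd L q u) S = of_bool (kind (val u S) = Ind)"
    unfolding kind_range_iff by (simp add: isInd_def)
  show "val (isLit L q u) S = of_bool (\<exists>c r. kind (val u S) = Lit c r)"
  proof (cases "(L + 2) * A \<le> val u S \<and> val u S < E")
    case True
    then have "(val u S - (L + 2) * A) div q < m" using div_less_m by blast
    with True show ?thesis unfolding kind_range_iff
      using start_origin[of "(val u S - (L + 2) * A) div q" 0]
      by (simp add: isLit_def clauseE_def posE_def arr2 I_start_length)
  next
    \<comment> \<open>The computed index may belong to no clause, making the table lookup arbitrary,
      but the range tests already fail.\<close>
    case False
    then show ?thesis unfolding kind_range_iff by (auto simp: isLit_def)
  qed
qed

lemma val_linkAsgE:
  "val (linkAsgE L q u v) S = of_bool (\<exists>g a. kind (val u S) = Asg g a \<and>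
      ((kind (val v S) = Clq \<or> kind (val v S) = Ind) \<and> g = 0 \<or>
      (\<exists>c r. kind (val v S) = Lit c r \<and> ((g = 0) \<noteq> mismatch g a c r))))"
proof (cases "\<exists>c r. kind (val v S) = Lit c r")
  case True
  then obtain c r where k: "kind (val v S) = Lit c r" by blast
  have cr: "c < m" "r < length (F ! c)" using k kind_Lit by blast+
  have "val (clauseE L q v) S = c" "val (posE L q v) S = r"
    using k unfolding kind_eq_Lit_iff by (simp_all add: clauseE_def posE_def)
  then show ?thesis using val_mismatchE[of "clauseE L q v" "posE L q v"] cr k
    by (auto simp: linkAsgE_def kind_eq_Asg_iff)
qed (auto simp: linkAsgE_def kind_eq_Asg_iff)

lemma val_adjE: "val (adjE L q u v) S = of_bool (adj (val u S) (val v S))"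
proof -
  have 1: "val (linkAsgsE L q u v) S = of_bool (\<exists>g a g' a'. kind (val u S) = Asg g a \<and>
      kind (val v S) = Asg g' a' \<and> (g' = g + 1 \<or> g = g' + 1 \<or> g = g' \<and> g \<noteq> 0))"
    by (auto simp: linkAsgsE_def kind_eq_Asg_iff)
  have 2: "val (linkCliqueE L q u v) S = of_bool
     ((kind (val u S) = Clq \<or> (\<exists>c r. kind (val u S) = Lit c r)) \<and>
      (kind (val v S) = Clq \<or> (\<exists>c r. kind (val v S) = Lit c r)))"
    by (simp add: linkCliqueE_def)
  show ?thesis
    unfolding adj_def link_iff adjE_def
    by (simp only: val_bool_exprs val_NotE val_linkAsgE 1 2 of_bool_eq_0_iff not_not disj_assoc)
qed

end

section \<open>Running the construction\<close>

context reduction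
begin

text \<open>The largest number stored while the instance is built is the final counter of the last
  loop.\<close>

definition "w = bit_length (N * N + K)"

lemma bit_length_le_w: "x \<le> N * N + K \<Longrightarrow> bit_length x \<le> w"
  unfolding w_def by (rule bit_length_mono)

lemma N_pos: "N \<ge> 1" by (simp add: N_def)

lemma bit_length_N: "x \<le> N \<Longrightarrow> bit_length x \<le> w"
  using N_pos by (intro bit_length_le_w) (simp add: trans_le_add1 order_trans[OF _ le_square])

definition arr1 :: "nat \<Rightarrow> nat \<Rightarrow> nat" where "arr1 = (\<lambda>_ _. 0)(1 := filled (\<lambda>y. 2 ^ y) h)"
definition arr2 :: "nat \<Rightarrow> nat \<Rightarrow> nat" where "arr2 = arr1(2 := filled start m)"
definition arr3 :: "nat \<Rightarrow> nat \<Rightarrow> nat" where "arr3 = arr2(3 := filled (\<lambda>i. K div 2 ^ i) K)"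
definition arr4 :: "nat \<Rightarrow> nat \<Rightarrow> nat" where "arr4 = arr3(4 := filled (instance_cell N adj K) (N * N + K))"

lemma arr_untouched:
  "arr1 2 = (\<lambda>_. 0)" "arr2 3 = (\<lambda>_. 0)" "arr3 4 = (\<lambda>_. 0)" "arr1 0 0 = 0" "arr2 0 0 = 0" "arr3 0 0 = 0"
  by (simp_all add: arr1_def arr2_def arr3_def)

lemma reduction_powersI: "(\<And>y. y \<le> h \<Longrightarrow> a 1 y = 2 ^ y) \<Longrightarrow> reduction_powers l q n F a"
  by unfold_locales

lemma reduction_tablesI:
  "(\<And>y. y \<le> h \<Longrightarrow> a 1 y = 2 ^ y) \<Longrightarrow> (\<And>c. c < m \<Longrightarrow> a 2 c = start c) \<Longrightarrow> reduction_tables l q n F a"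
  by unfold_locales

lemma pow_le: "y \<le> h \<Longrightarrow> (2::nat) ^ y \<le> N"
  using bounds(5) unfolding A_def by (meson one_le_numeral order_trans power_increasing)

lemma bit_length_filled:
  assumes "\<And>x. x \<le> k \<Longrightarrow> bit_length (f x) \<le> w"
  shows "bit_length (filled f k x) \<le> w"
  using assms bit_length_N[of 0] by (simp add: filled_def)

lemma bit_length_arr1: "bit_length (arr1 j i) \<le> w"
  using bit_length_N[OF pow_le] bit_length_N[of 0] by (auto simp: arr1_def intro: bit_length_filled)

lemma bit_length_arr2: "bit_length (arr2 j i) \<le> w"
  using bit_length_N[OF start_le_N] bit_length_arr1 by (auto simp: arr2_def intro: bit_length_filled)

lemma bit_length_quot: "bit_length (K div 2 ^ i) \<le> w"
  using bounds(3) by (intro bit_length_N) (meson div_le_dividend order_trans)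

lemma bit_length_arr3: "bit_length (arr3 j i) \<le> w"
  using bit_length_quot bit_length_arr2 by (auto simp: arr3_def intro: bit_length_filled)

lemma instance_cell_le: "instance_cell N adj K x \<le> N"
proof (cases x)
  case (Suc i)
  have "Suc (K div 2 ^ (i - N * N) mod 2) \<le> 2" by simp
  moreover have "N \<ge> 2" using A_ge_2 bounds(5) by simp
  ultimately show ?thesis using Suc by (simp add: instance_cell_def Let_def)
qed (simp add: instance_cell_def)

lemma fill_pow:
  "halts_within (fill q 1 (Num 1) (hE L) (powStep q)) (layout q I (\<lambda>_ _. 0))
     (w * fill_const q 1 (Num 1) (hE L) (powStep q) * Suc h) (layout q I arr1)"
  unfolding arr1_def
  by (rule halts_within_fill)
    (use bit_length_N[OF I_le] bit_length_N[OF pow_le] bit_length_N[of 0] bit_length_N[of h] bounds in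
      \<open>auto simp: upd_def filled_def hE_def h_def powStep_def\<close>)

lemma fill_start:
  "halts_within (fill q 2 (Num 2) (Mem (Num 1)) (startStep q)) (layout q I arr1)
     (w * fill_const q 2 (Num 2) (Mem (Num 1)) (startStep q) * Suc m) (layout q I arr2)"
  unfolding arr2_def
proof (rule halts_within_fill)
  fix i assume i: "i < m"
  show "val (startStep q) (layout q I (upd (arr1(2 := filled start i)) 0 0 i)) = start (Suc i)"
    using start_origin[OF i, of 0] I_start_length[OF i]
    by (simp add: startStep_def upd_def filled_def)
qed (use bit_length_N[OF I_le] bit_length_arr1 bit_length_N[OF start_le_N] bit_length_N[of m] bounds in
      \<open>auto simp: arr_untouched\<close>)

lemma fill_quot:
  "halts_within (fill q 3 (KE L q) (KE L q) (quotStep q)) (layout q I arr2)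
     (w * fill_const q 3 (KE L q) (KE L q) (quotStep q) * Suc K) (layout q I arr3)"
  unfolding arr3_def
proof (rule halts_within_fill)
  have "reduction_powers l q n F arr2"
    by (rule reduction_powersI) (simp add: arr1_def arr2_def filled_def)
  then show "val (KE L q) (layout q I arr2) = K div 2 ^ 0"
    by (simp add: reduction_powers.val_sizes)
  fix i
  have "reduction_powers l q n F (upd (arr2(3 := filled (\<lambda>i. K div 2 ^ i) i)) 0 0 i)"
    by (rule reduction_powersI) (simp add: arr1_def arr2_def filled_def upd_def)
  then show "val (KE L q) (layout q I (upd (arr2(3 := filled (\<lambda>i. K div 2 ^ i) i)) 0 0 i)) = K"
    by (rule reduction_powers.val_sizes)
  show "val (quotStep q) (layout q I (upd (arr2(3 := filled (\<lambda>i. K div 2 ^ i) i)) 0 0 i)) = K div 2 ^ Suc i"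
    by (simp add: quotStep_def upd_def filled_def div_mult2_eq mult.commute[of 2])
qed (use bit_length_N[OF I_le] bit_length_arr2 bit_length_quot bit_length_N[of K] bounds in
      \<open>auto simp: arr_untouched\<close>)

lemma fill_instance:
  "halts_within (fill q 4 (NE L q) (instanceBound L q) (instanceStep L q)) (layout q I arr3)
     (w * fill_const q 4 (NE L q) (instanceBound L q) (instanceStep L q) * Suc (N * N + K)) (layout q I arr4)"
  unfolding arr4_def
proof (rule halts_within_fill)
  let ?f = "instance_cell N adj K"
  have "reduction_powers l q n F arr3"
    by (rule reduction_powersI) (simp add: arr1_def arr2_def arr3_def filled_def)
  then show "val (NE L q) (layout q I arr3) = ?f 0"
    by (simp add: reduction_powers.val_sizes instance_cell_def)
  fix i
  let ?a = "upd (arr3(4 := filled ?f i)) 0 0 i"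
  \<comment> \<open>The loop changes array 4 and the counter, but not the two tables behind
    adjacency.\<close>
  interpret s: reduction_tables l q n F ?a
    by (rule reduction_tablesI) (simp_all add: arr1_def arr2_def arr3_def filled_def upd_def)
  show "val (instanceBound L q) (layout q I ?a) = N * N + K" by simp
  assume i: "i < N * N + K"
  have c: "val (cnt q) (layout q I ?a) = i" by (simp add: upd_def)
  show "val (instanceStep L q) (layout q I ?a) = ?f (Suc i)"
  proof (cases "i < N * N")
    case True
    then show ?thesis
      using c by (simp add: instanceStep_def s.val_adjE instance_cell_def del: val_Cell)
  next
    case False
    then have "?a 3 (i - N * N) = K div 2 ^ (i - N * N)"
      using i by (simp add: arr3_def upd_def filled_def)
    then have "val (Cell q 3 (Minus (cnt q) (NNE L q))) (layout q I ?a) = K div 2 ^ (i - N * N)"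
      using c by simp
    with False show ?thesis
      using c by (simp add: instanceStep_def instance_cell_def Let_def del: val_Cell)
  qed
qed (use bit_length_N[OF I_le] bit_length_arr3 bit_length_N[OF instance_cell_le] bit_length_le_w in
      \<open>auto simp: arr_untouched\<close>)

lemma halts_within_build_instance:
  "halts_within (build_instance L q) (layout q I (\<lambda>_ _. 0))
    (w * build_const L q * Suc (N * N + K)) (layout q I arr4)"
proof -
  have "m \<le> N * N + K" "h \<le> N * N + K"
    using bounds(2,4) le_square[of N] by linarith+
  then have "w * c * Suc m \<le> w * c * Suc (N * N + K)" "w * c * Suc h \<le> w * c * Suc (N * N + K)"
    "w * c * Suc K \<le> w * c * Suc (N * N + K)" for c
    by (intro mult_le_mono2; simp)+
  note le = this
  show ?thesis
    unfolding build_instance_def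
    by (rule halts_within_mono[OF halts_within_Seq[OF halts_within_Seq[OF fill_pow fill_start]
            halts_within_Seq[OF fill_quot fill_instance]]])
      (unfold build_const_def distrib_left distrib_right, intro add_mono le order_refl)
qed

text \<open>The summands pay for building the instance, simulating \<open>P\<close> on it, and
  reducing the count to 0 or 1.\<close>

lemma computes_within_decide_sat:
  assumes "counts_scorpions_in_time l P T"
  shows "computes_within (decide_sat L q P) (encode_cnf n F) (of_bool (satisfiable F))
    (w * build_const L q * Suc (N * N + K) + 2 * (w * overhead q) * T N
      + (1 + 2 * (w * overhead q) * (N + 7)))"
proof -
  have "K \<ge> 1" by (simp add: K_def)
  then have "computes_within P (encode_graph N G @ map Suc (binary_digits K)) (scorpion_count l G K) (T N)"
    using assms graph_G unfolding counts_scorpions_in_time_def by simp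
  then obtain t mm where t: "exec P (arr4 4) t mm" "mm 0 = scorpion_count l G K" "t \<le> T N"
    unfolding computes_within_def input_mem_encode_graph arr4_def by auto
  have Iw: "bit_length (I 1) \<le> w" by (rule bit_length_N[OF I_le])
  obtain arr' where a: "arr' 4 = mm"
    "halts_within (trans_prog q P) (layout q I arr4) (2 * (w * overhead q) * t) (layout q I arr')"
    using exec_trans_prog[of P _ t mm arr4 I w q, OF t(1) refl Iw] by blast
  have 1: "halts_within (trans_prog q P) (layout q I arr4) (2 * (w * overhead q) * T N) (layout q I arr')"
    by (rule halts_within_mono[OF a(2)]) (simp add: t(3))
  let ?e = "NotE (NotE (Mem (Num 0)))"
  let ?s = "layout q I arr'"
  have "bit_length (mm 0) \<le> Suc N"
    unfolding t(2) by (rule bit_length_le) (use scorpion_count_le[of K] in \<open>auto intro: le_less_trans\<close>)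
  then have "cost ?e mm \<le> N + 7"
  proof -
    have "bit_length (Suc 0 - x) = 1" for x by (cases x) (auto simp: bit_length_def)
    with \<open>bit_length (mm 0) \<le> Suc N\<close> show ?thesis by (simp add: NotE_def bit_length_numerals bit_length_def[of 0])
  qed
  then have "cost (trans_expr q ?e) ?s \<le> 2 * (w * overhead q) * (N + 7)"
    by (intro order_trans[OF cost_trans_expr[of I w q ?e arr', OF Iw]]) (simp add: a(1))
  then have 2: "halts_within (Store (Num 0) (trans_expr q ?e)) ?s (1 + 2 * (w * overhead q) * (N + 7))
      (?s(0 := of_bool (satisfiable F)))"
    using exec.Store[of "Num 0" "trans_expr q ?e" ?s] a(1) t(2) scorpion_count_pos_iff
    unfolding halts_within_def
    by (intro exI[of _ "cost (Num 0) ?s + cost (trans_expr q ?e) ?s"]) (auto simp: bit_length_def)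
  from halts_within_Seq[OF halts_within_Seq[OF halts_within_build_instance 1] 2]
  show ?thesis
    unfolding computes_within_def decide_sat_def halts_within_def layout_input_list
    by (elim exE conjE) (intro exI conjI, assumption, simp_all)
qed

text \<open>Clauses are distinct as sets, and each is the set of a list of at most \<open>q\<close>
  of the \<open>2 * n\<close> literals. For fixed \<open>q\<close> their number is polynomial in
  \<open>n\<close>, hence negligible beside \<open>A\<close>.\<close>

lemma m_le: "m \<le> (q + 1) * (2 * n + 1) ^ q"
proof -
  let ?V = "{..<n} \<times> (UNIV :: bool set)"
  let ?S = "{xs. set xs \<subseteq> ?V \<and> length xs \<le> q}"
  have "m = card (set (map set F))"
    using cnf unfolding is_cnf_def m_def by (metis distinct_card length_map)
  also have "\<dots> \<le> card (set ` ?S)"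
    using cnf finite_lists_length_le[of ?V q] unfolding is_cnf_def
    by (intro card_mono) fastforce+
  also have "\<dots> \<le> card ?S" by (rule card_image_le) (simp add: finite_lists_length_le)
  also have "\<dots> = (\<Sum>i\<le>q. (2 * n) ^ i)"
    by (subst card_lists_length_le) (simp_all add: card_cartesian_product mult.commute)
  also have "\<dots> \<le> (\<Sum>i\<le>q. (2 * n + 1) ^ q)"
    by (intro sum_mono order_trans[OF power_mono power_increasing]) auto
  finally show ?thesis by simp
qed

end

section \<open>Running time\<close>

lemma poly_bigo_exp:
  fixes q :: nat and c :: real
  assumes "c > 0"
  shows "(\<lambda>n::nat. (2 * real n + 1) ^ q) \<in> O(\<lambda>n. 2 powr (c * real n))"
  using assms by real_asymp

text \<open>The finitely many exceptional arguments are absorbed by the constant, as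
  \<open>g\<close> is bounded away from 0.\<close>

lemma bigo_nat_bound:
  fixes f :: "nat \<Rightarrow> real"
  assumes "f \<in> O(g)" and "\<And>n. g n \<ge> 1"
  shows "\<exists>C>0. \<forall>n. f n \<le> C * g n"
proof -
  obtain c where c: "c > 0" "eventually (\<lambda>n. norm (f n) \<le> c * norm (g n)) sequentially"
    using assms(1) by (elim landau_o.bigE)
  then obtain n0 where n0: "\<And>n. n \<ge> n0 \<Longrightarrow> \<bar>f n\<bar> \<le> c * \<bar>g n\<bar>"
    by (auto simp: eventually_at_top_linorder)
  define D where "D = (\<Sum>n<n0. \<bar>f n\<bar>)"
  have D: "D \<ge> 0" unfolding D_def by (intro sum_nonneg) auto
  have "f n \<le> (c + D) * g n" for n
  proof (cases "n \<ge> n0")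
    case True
    then have "f n \<le> c * g n" using n0[OF True] assms(2)[of n] by simp
    moreover have "0 \<le> D * g n" using D assms(2)[of n] by simp
    ultimately show ?thesis by (simp add: distrib_right)
  next
    case False
    then have "\<bar>f n\<bar> \<le> D" unfolding D_def by (intro member_le_sum) auto
    moreover have "D * 1 \<le> D * g n" using D assms(2)[of n] by (intro mult_left_mono) auto
    moreover have "0 \<le> c * g n" using c(1) assms(2)[of n] by simp
    ultimately show ?thesis by (simp add: distrib_right)
  qed
  moreover have "c + D > 0" using c(1) D by simp
  ultimately show ?thesis by blast
qed

text \<open>This absorbs the word length into an arbitrarily small power; \<open>N * N + K\<close>
  meets the bound \<open>2 * x * x\<close> for \<open>x = N\<close>.\<close>

lemma bit_length_le_powr:
  assumes "x \<ge> 1" and "y \<le> 2 * x * x" and "\<delta> > 0"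
  shows "real (bit_length y) \<le> (2 + 4 / \<delta>) * real x powr \<delta>"
proof -
  have x: "real x \<ge> 1" using assms(1) by simp
  have "real (floor_log (2 * x * x)) \<le> log 2 (real (2 * x * x))"
  proof -
    have "1 * 1 \<le> (2 * real x) * real x" using x by (intro mult_mono) auto
    then show ?thesis using x by (simp add: floor_log_altdef of_nat_floor)
  qed
  also have "\<dots> = 1 + 2 * log 2 (real x)"
    using x by (simp add: log_mult)
  finally have "real (bit_length (2 * x * x)) \<le> 2 + 2 * (ln (real x) / ln 2)"
    by (simp add: bit_length_def log_def)
  also have "ln (real x) / ln 2 \<le> ln (real x) / (1 / 2)"
    using x ln_ge_iff[of 2 "1 / 2"] exp_half_le2 by (intro divide_left_mono) auto
  also have "ln (real x) \<le> real x powr \<delta> / \<delta>"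
    using x assms(3) by (rule ln_powr_bound)
  finally have "real (bit_length (2 * x * x)) \<le> 2 + 4 / \<delta> * real x powr \<delta>"
    by (simp add: field_simps)
  moreover have "1 \<le> real x powr \<delta>" using x assms(3) by (simp add: ge_one_powr_ge_zero)
  moreover have "real (bit_length y) \<le> real (bit_length (2 * x * x))"
    using bit_length_mono[OF assms(2)] by simp
  ultimately show ?thesis by (simp add: distrib_right)
qed

text \<open>The given exponent may be negative for large \<open>\<epsilon>\<close>; a nonnegative
  \<open>b\<close> makes the comparison function at least 1. The maximum with 1 avoids
  \<open>0 powr b = 0\<close>.\<close>

lemma bigo_powr_bound:
  assumes "(\<lambda>n. real (T n)) \<in> O(\<lambda>n. real n powr a)" and "a \<le> b" and "b \<ge> 0"
  shows "\<exists>C>0. \<forall>n\<ge>1. real (T n) \<le> C * real n powr b"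
proof -
  let ?g = "\<lambda>n. real (max n 1) powr b"
  have "(\<lambda>n. real n powr a) \<in> O(?g)"
  proof (rule bigoI[of _ 1], rule eventuallyI)
    fix n :: nat
    show "norm (real n powr a) \<le> 1 * norm (?g n)"
    proof (cases "n = 0")
      case False
      then have "max n 1 = n" by simp
      then show ?thesis using powr_mono[OF assms(2), of "real n"] False by simp
    qed simp
  qed
  then have "(\<lambda>n. real (T n)) \<in> O(?g)" by (rule landau_o.big_trans[OF assms(1)])
  moreover have "?g n \<ge> 1" for n using assms(3) by (intro ge_one_powr_ge_zero) auto
  ultimately obtain C where "C > 0" "\<forall>n. real (T n) \<le> C * ?g n"
    using bigo_nat_bound by blast
  moreover have "max n 1 = n" if "n \<ge> 1" for n :: nat using that by simp
  ultimately show ?thesis by metis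
qed

text \<open>Each group has \<open>2 ^ (n div L + 1)\<close> assignments, at most twice
  \<open>2 powr (n / L)\<close>, and the clause slots are polynomially many.\<close>

lemma graph_size_bound:
  assumes "q \<ge> 1" and "l \<ge> 1"
  shows "\<exists>C>0. \<forall>n F. is_cnf q n F \<longrightarrow> real (reduction.N l q n F) \<le> C * 2 powr (real n / real (l + 2))"
proof -
  let ?L = "l + 2"
  have "(\<lambda>n::nat. (2 * real n + 1) ^ q) \<in> O(\<lambda>n. 2 powr (1 / real ?L * real n))"
    by (rule poly_bigo_exp) simp
  moreover have "1 \<le> 2 powr (1 / real ?L * real n)" for n :: nat
    by (intro ge_one_powr_ge_zero) auto
  ultimately obtain C where C: "C > 0" "\<And>n. (2 * real n + 1) ^ q \<le> C * 2 powr (1 / real ?L * real n)"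
    using bigo_nat_bound by blast
  define D where "D = 4 * (real ?L + 2) + 2 * real q * (real q + 1) * C + 1"
  have "real (reduction.N l q n F) \<le> D * 2 powr (real n / real ?L)" if "is_cnf q n F" for n F
  proof -
    interpret reduction l q n F using assms that by unfold_locales
    let ?z = "2 powr (real n / real ?L)"
    have z: "?z \<ge> 1" by (intro ge_one_powr_ge_zero) auto
    have "real m \<le> (real q + 1) * (2 * real n + 1) ^ q"
    proof -
      have "real m \<le> real ((q + 1) * (2 * n + 1) ^ q)" using m_le by (simp only: of_nat_le_iff)
      then show ?thesis by (simp add: algebra_simps)
    qed
    also have "\<dots> \<le> (real q + 1) * (C * ?z)"
      using C(2)[of n] by (intro mult_left_mono) simp_all
    finally have "real m \<le> (real q + 1) * (C * ?z)" .
    then have m: "real q * real m \<le> real q * ((real q + 1) * (C * ?z))" by (intro mult_left_mono) auto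
    have "real A = 2 powr real (n div ?L + 1)"
      by (simp add: A_def h_def L_def powr_realpow powr_add)
    also have "\<dots> = 2 powr real (n div ?L) * 2" by (simp add: powr_add)
    also have "2 powr real (n div ?L) \<le> ?z"
      using of_nat_div_le_of_nat[of n ?L, where 'a = real] by (intro powr_mono) auto
    finally have A: "real A \<le> 2 * ?z" by simp
    then have A: "(real ?L + 2) * real A \<le> (real ?L + 2) * (2 * ?z)" by (intro mult_left_mono) auto
    have "real N = 2 * ((real ?L + 2) * real A + real q * real m) + 1"
      by (simp add: N_def E_def L_def algebra_simps)
    also have "\<dots> \<le> 2 * ((real ?L + 2) * (2 * ?z) + real q * ((real q + 1) * (C * ?z))) + ?z"
      by (intro add_mono mult_left_mono m A z) simp
    also have "\<dots> = D * ?z" by (simp add: D_def algebra_simps)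
    finally show ?thesis .
  qed
  moreover have "D > 0" using C(1) unfolding D_def by (intro add_nonneg_pos) auto
  ultimately show ?thesis by blast
qed

text \<open>As \<open>N\<close> is of order \<open>2 powr (n / L)\<close>, time
  \<open>N powr (L - \<epsilon>)\<close> becomes \<open>2 powr ((1 - \<epsilon> / L) * n)\<close> up
  to constants. Half of the gain is given up for the logarithmic factor.\<close>

lemma decide_sat_time:
  fixes \<epsilon> :: real
  assumes P: "counts_scorpions_in_time l P T"
    and T: "(\<lambda>n. real (T n)) \<in> O(\<lambda>n. real n powr (real l + 2 - \<epsilon>'))"
    and l: "l \<ge> 1" and q: "q \<ge> 1" and \<epsilon>: "0 < \<epsilon>" "\<epsilon> \<le> 1" "\<epsilon> \<le> \<epsilon>'"
  shows "\<exists>D>0. \<forall>n F. is_cnf q n F \<longrightarrow> (\<exists>t. computes_within (decide_sat (l + 2) q P) (encode_cnf n F)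
      (of_bool (satisfiable F)) t \<and> real t \<le> D * 2 powr ((1 - \<epsilon> / (2 * real (l + 2))) * real n))"
proof -
  let ?L = "l + 2"
  define e where "e = real ?L - \<epsilon>"
  \<comment> \<open>By \<open>L \<ge> 3\<close> and \<open>\<epsilon> \<le> 1\<close>; so writing a
    matrix with \<open>N * N\<close> entries is within the bound.\<close>
  have e: "e \<ge> 2" using \<epsilon> l by (simp add: e_def)
  obtain C1 where C1: "C1 > 0" "\<And>n. n \<ge> 1 \<Longrightarrow> real (T n) \<le> C1 * real n powr e"
    using bigo_powr_bound[OF T, of e] e \<epsilon> by (auto simp: e_def)
  obtain C2 where C2: "C2 > 0"
    "\<And>n F. is_cnf q n F \<Longrightarrow> real (reduction.N l q n F) \<le> C2 * 2 powr (real n / real ?L)"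
    using graph_size_bound[OF q l] by blast
  define B where "B = real (build_const ?L q)"
  define V where "V = real (overhead q)"
  define H where "H = B * 3 + 2 * V * C1 + (1 + 2 * V * 8)"
  define D where "D = (2 + 4 / (\<epsilon> / 2)) * H * C2 powr (e + \<epsilon> / 2)"
  have nonneg: "B \<ge> 0" "V \<ge> 0" by (simp_all add: B_def V_def)
  then have "0 \<le> B * 3" "0 \<le> 2 * V * C1" "0 \<le> 2 * V * 8" using C1(1) by auto
  then have H: "H > 0" unfolding H_def by linarith
  then have D: "D > 0" using \<epsilon> C2(1) unfolding D_def by (intro mult_pos_pos add_pos_pos) auto
  have "\<exists>t. computes_within (decide_sat ?L q P) (encode_cnf n F)
      (of_bool (satisfiable F)) t \<and> real t \<le> D * 2 powr ((1 - \<epsilon> / (2 * real ?L)) * real n)"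
    if F: "is_cnf q n F" for n F
  proof -
    interpret reduction l q n F using q l F by unfold_locales
    let ?t = "w * build_const L q * Suc (N * N + K) + 2 * (w * overhead q) * T N
      + (1 + 2 * (w * overhead q) * (N + 7))"
    have L: "L = ?L" by (simp add: L_def)
    have x: "real N \<ge> 1" using N_pos by simp
    define X where "X = real N powr e"
    have N2: "real N * real N \<le> X"
      using powr_mono[OF e x] x by (simp add: X_def powr_realpow[of "real N" 2, simplified] power2_eq_square)
    have N1: "real N \<le> real N * real N" using x mult_left_mono[of 1 "real N" "real N"] by simp
    have w1: "real w \<ge> 1" using bit_length_pos by (simp add: w_def Suc_le_eq bit_length_def)
    have X1: "X \<ge> 1" using N1 N2 x by linarith
    have a: "real (Suc (N * N + K)) \<le> 3 * X"
    proof -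
      have "real K \<le> real N" using bounds(3) by simp
      then show ?thesis using N1 N2 x unfolding of_nat_Suc of_nat_add of_nat_mult by linarith
    qed
    have b: "real (N + 7) \<le> 8 * X" using N1 N2 x unfolding of_nat_add of_nat_numeral by linarith
    have c: "real (T N) \<le> C1 * X" using C1(2)[OF N_pos] by (simp add: X_def)
    have "1 \<le> real w * X" using mult_mono[OF w1 X1] by simp
    have "real ?t = real w * B * real (Suc (N * N + K)) + 2 * (real w * V) * real (T N)
      + (1 + 2 * (real w * V) * real (N + 7))"
      unfolding of_nat_add of_nat_mult B_def V_def L by simp
    also have "\<dots> \<le> real w * B * (3 * X) + 2 * (real w * V) * (C1 * X)
        + (real w * X + 2 * (real w * V) * (8 * X))"
      using a b c nonneg \<open>1 \<le> real w * X\<close> by (intro add_mono mult_left_mono) auto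
    also have "\<dots> = real w * (H * X)" by (simp add: H_def algebra_simps)
    also have "\<dots> \<le> ((2 + 4 / (\<epsilon> / 2)) * real N powr (\<epsilon> / 2)) * (H * X)"
    proof (rule mult_right_mono)
      have "N * N + K \<le> 2 * N * N" using bounds(3) le_square[of N] unfolding mult.assoc by linarith
      then show "real w \<le> (2 + 4 / (\<epsilon> / 2)) * real N powr (\<epsilon> / 2)"
        unfolding w_def using N_pos \<epsilon> by (intro bit_length_le_powr) auto
    qed (use H X1 in auto)
    also have "\<dots> = (2 + 4 / (\<epsilon> / 2)) * H * real N powr (e + \<epsilon> / 2)"
      by (simp add: X_def powr_add)
    also have "\<dots> \<le> (2 + 4 / (\<epsilon> / 2)) * H * (C2 * 2 powr (real n / real ?L)) powr (e + \<epsilon> / 2)"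
      using C2(2)[OF F] H \<epsilon> e by (intro mult_left_mono powr_mono2) auto
    also have "\<dots> = D * 2 powr (real n / real ?L * (e + \<epsilon> / 2))"
      using C2(1) by (simp add: D_def powr_mult powr_powr)
    also have "real n / real ?L * (e + \<epsilon> / 2) = (1 - \<epsilon> / (2 * real ?L)) * real n"
      by (simp add: e_def field_simps)
    finally show ?thesis using computes_within_decide_sat[OF P] unfolding L by blast
  qed
  with D show ?thesis by blast
qed

theorem proposition4p5:
  fixes l :: nat and \<epsilon> :: real
  assumes "SETH" and "l \<ge> 3" and "\<epsilon> > 0"
  shows "\<not> (\<exists>P T. counts_scorpions_in_time l P T \<and>
               (\<lambda>n. real (T n)) \<in> O(\<lambda>n. real n powr (real l + 2 - \<epsilon>)))"
proof
  assume "\<exists>P T. counts_scorpions_in_time l P T \<and>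
               (\<lambda>n. real (T n)) \<in> O(\<lambda>n. real n powr (real l + 2 - \<epsilon>))"
  then obtain P T where PT: "counts_scorpions_in_time l P T"
    "(\<lambda>n. real (T n)) \<in> O(\<lambda>n. real n powr (real l + 2 - \<epsilon>))" by blast
  \<comment> \<open>Cutting \<open>\<epsilon>\<close> at 1 keeps the exponent at least 2; the factor
    2 in the denominator leaves room for logarithms.\<close>
  define \<delta> where "\<delta> = min \<epsilon> 1 / (2 * real (l + 2))"
  have "\<delta> > 0" using assms(3) by (simp add: \<delta>_def)
  with assms(1) obtain q where q: "q \<ge> 3"
    "\<not> (\<exists>P T. decides_sat_in_time q P T \<and> (\<lambda>n. real (T n)) \<in> O(\<lambda>n. 2 powr ((1 - \<delta>) * real n)))"
    unfolding SETH_def by blast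
  obtain D where D: "D > 0" "\<And>n F. is_cnf q n F \<Longrightarrow>
      \<exists>t. computes_within (decide_sat (l + 2) q P) (encode_cnf n F) (of_bool (satisfiable F)) t \<and>
        real t \<le> D * 2 powr ((1 - \<delta>) * real n)"
    using decide_sat_time[OF PT, of q "min \<epsilon> 1"] assms(2,3) q(1) unfolding \<delta>_def by auto
  define T' where "T' n = nat \<lfloor>D * 2 powr ((1 - \<delta>) * real n)\<rfloor>" for n
  have "decides_sat_in_time q (decide_sat (l + 2) q P) T'"
    unfolding decides_sat_in_time_def
  proof (intro allI impI)
    fix n F assume "is_cnf q n F"
    then obtain t where t: "computes_within (decide_sat (l + 2) q P) (encode_cnf n F) (of_bool (satisfiable F)) t"
      "real t \<le> D * 2 powr ((1 - \<delta>) * real n)" using D(2) by blast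
    then have "t \<le> T' n" unfolding T'_def by (simp add: le_nat_floor)
    with t(1) show "computes_within (decide_sat (l + 2) q P) (encode_cnf n F) (of_bool (satisfiable F)) (T' n)"
      unfolding computes_within_def by (meson order_trans)
  qed
  moreover have "(\<lambda>n. real (T' n)) \<in> O(\<lambda>n. 2 powr ((1 - \<delta>) * real n))"
    using D(1) by (intro bigoI[of _ D] eventuallyI) (simp add: T'_def of_nat_floor)
  ultimately show False using q(2) by blast
qed

end
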